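(* Let $P,\mathcal{E},\mathcal{E}',Q,Q'$ be probabilistic concurrent programs and let $R,R',G,G',R''$ be probabilistic rely/guarantee conditions, with $R''\sqsubseteq_{\mathrm{sim}}R$ and $R''\sqsubseteq_{\mathrm{sim}}R'$. Suppose that $$\{P\ R\}\,\mathcal{E}\,\{G\ Q\},\qquad \{P\ R'\}\,\mathcal{E}'\,\{G'\ Q'\},\qquad G\sqsubseteq_{\mathrm{sim}}R',\qquad G'\sqsubseteq_{\mathrm{sim}}R.$$ Then $$\{P\ R''\}\,\mathcal{E}\|\mathcal{E}'\,\{G\|G'\ \ Q\}.$$
   Context: **Programs.** $\Omega$ is a fixed finite set of states. $\mathbb{D}\Omega$ is the set of distributions on $\Omega$, viewed inside $\mathbb{R}^\Omega$; $\mathbb{D}_{\le 1}\Omega$ is the set of subdistributions; $\delta_s$ is the point distribution at $s$. $\mathbb{H}_1\Omega$ is the set of maps $r:\Omega\to\mathcal{P}(\mathbb{D}\Omega)$ such that each $r(s)$ is non-empty, convex and topologically closed. A test is a map $b:\Omega\to\mathcal{P}(\mathbb{D}\Omega)$ with $b(s)\subseteq\{\delta_s\}$. $\overline{\mathbb{H}}_1\Omega$ is $\mathbb{H}_1\Omega$ together with all tests, ordered by $r\sqsubseteq_{\mathbb{H}}r'$ iff $r(s)\subseteq r'(s)$ for all $s$. $\delta$ denotes the program $\delta(s)=\{\delta_s\}$. **ipBES.** A bundle event structure with internal probability (ipBES) is $\mathcal{E}=(E,\mapsto,\#,\lambda,\mathbf{\Phi})$ where $E$ is a set of events; $\#$ is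 an irreflexive symmetric relation on $E$; for $x,x'\subseteq E$, $x\#x'$ means $e\#e'$ for all $e\in x,e'\in x'$ with $e\ne e'$; $\mapsto\subseteq\mathcal{P}(E)\times E$ satisfies $x\#x$ whenever $x\mapsto e$; $\lambda:E\to\overline{\mathbb{H}}_1\Omega$; $\mathbf{\Phi}\subseteq\mathcal{P}(E)$ with $x\#x$ for $x\in\mathbf{\Phi}$. $\mathbf{in}(\mathcal{E})$ is the set of initial events, i.e. events $e$ with no bundle $x\mapsto e$. **Traces.** A finite trace is a finite sequence $e_1\cdots e_n$ of distinct, pairwise non-conflicting events such that for every $j$ and every bundle $x\mapsto e_j$ there is $i<j$ with $e_i\in x$. $\mathcal{T}(\mathcal{E})$ is the set of finite traces (empty trace $\emptyset$), $\mathcal{T}_{\max}(\mathcal{E})$ the set of prefix-maximal ones. A trace $\alpha$ is weakly maximal if it is maximal or there are events $e_1,\dots,e_n$ with $\alpha e_1\cdots e_n\in\mathcal{T}_{\max}(\mathcal{E})$ and $\delta\sqsubseteq_{\mathbb{H}}\lambda(e_i)$ for all $i$. **Schedulers and semantics.** A scheduler $\sigma$ on $\mathcal{E}$ assigns to each $\alpha\in\mathcal{T}(\mathcal{E})$ a partial function $\sigma(\alpha):E\times\Omega\rightharpoonup\mathbb{D}_{\le1}\Omega$ with domain $\{(e,s):\alpha e\in\mathcal{T}(\mathcal{E}),\,s\in\Omega\}$ for which there is $w:E\times\Omega\to[0,1]$ (depending on $\alpha$) such that for $(e,s)$ in the domain: if $\lambda(e)(s)\neq\emptyset$ then $\sigma(\alpha)(e,s)=w(e,s)\mu$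 for some $\mu\in\lambda(e)(s)$; if $\lambda(e)(s)=\emptyset$ then $w(e,s)=0$ and $\sigma(\alpha)(e,s)=0$; and, when the domain is non-empty, $\sum_{e:\alpha e\in\mathcal{T}(\mathcal{E})}w(e,s)=1$ for every $s$. From initial state $s$, define $\varphi_s(\emptyset)=\delta_s$, $\varphi_s(\alpha e)(u)=\sum_{t\in\Omega}\sigma(\alpha)(e,t)(u)\varphi_s(\alpha)(t)$, and $\sigma_s(\mathcal{E})=\sum_{\alpha\in\mathcal{T}_{\max}(\mathcal{E})}\varphi_s(\alpha)$. $\mathbf{Sched}_1(\mathcal{E})$ is the set of schedulers $\sigma$ such that $\sigma_s(\mathcal{E})$ is a distribution for every $s$. $\mathcal{E}$ is feasible if for every $\alpha\in\mathcal{T}(\mathcal{E})\setminus\mathcal{T}_{\max}(\mathcal{E})$, $\bigcup_{\alpha e\in\mathcal{T}(\mathcal{E})}\{s:\lambda(e)(s)\ne\emptyset\}=\Omega$; it is terminating if $\mathbf{Sched}_1(\mathcal{E})\neq\emptyset$. $[\![\mathcal{E}]\!](s)$ is the topological closure of the convex hull of $\{\sigma_s(\mathcal{E}):\sigma\in\mathbf{Sched}_1(\mathcal{E})\}$, and $\mathcal{E}\sqsubseteq\mathcal{F}$ means $[\![\mathcal{E}]\!]\sqsubseteq_{\mathbb{H}}[\![\mathcal{F}]\!]$. A probabilistic concurrent program is a feasible and terminating ipBES. **t-simulation.** A function $f:\mathcal{T}(\mathcal{E})\to\mathcal{T}(\mathcal{F})$ is a t-simulation if: (i) $f(\emptyset)=\emptyset$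 and $f^{-1}(\beta)$ is finite for every $\beta\in\mathcal{T}(\mathcal{F})$; (ii) if $\alpha e\in\mathcal{T}(\mathcal{E})$ then either $f(\alpha e)=f(\alpha)$ and $\lambda(e)\sqsubseteq_{\mathbb{H}}\delta$, or there is an event $e'$ of $\mathcal{F}$ with $\lambda(e)\sqsubseteq_{\mathbb{H}}\lambda(e')$ and $f(\alpha e)=f(\alpha)e'$; (iii) if $\alpha e$ is maximal in $\mathcal{T}(\mathcal{E})$ then $f(\alpha e)=f(\alpha)e'$ for some $e'$ with $\lambda(e)\sqsubseteq_{\mathbb{H}}\lambda(e')$, and $f(\alpha e)$ is weakly maximal in $\mathcal{T}(\mathcal{F})$. $\mathcal{E}\sqsubseteq_{\mathrm{sim}}\mathcal{F}$ means there is a t-simulation from $\mathcal{E}$ to $\mathcal{F}$. **Operations on ipBES** (event sets of the operands are taken disjoint, using fresh copies if necessary). - $0$ is the structure with no events and $\mathbf{\Phi}=\emptyset$; by convention $0\cdot\mathcal{E}=\mathcal{E}\cdot0=\mathcal{E}$. - $\mathcal{E}\cdot\mathcal{F}$ has events $E\cup F$, conflict $\#_{\mathcal{E}}\cup\#_{\mathcal{F}}$, bundles $\mapsto_{\mathcal{E}}\cup\mapsto_{\mathcal{F}}\cup\{x\mapsto e: x\in\mathbf{\Phi}_{\mathcal{E}},e\in\mathbf{in}(\mathcal{F})\}$, labels $\lambda_{\mathcal{E}}\cup\lambda_{\mathcal{F}}$, exit sets $\mathbf{\Phi}_{\mathcal{F}}$. - $\mathcal{E}\|\mathcal{F}=(E\cup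 F,\ \mapsto_{\mathcal{E}}\cup\mapsto_{\mathcal{F}},\ \#_{\mathcal{E}}\cup\#_{\mathcal{F}},\ \lambda_{\mathcal{E}}\cup\lambda_{\mathcal{F}},\ \mathbf{\Phi}_{\mathcal{E}}\cup\mathbf{\Phi}_{\mathcal{F}})$. **Rely-guarantee.** A probabilistic rely or guarantee condition is a probabilistic concurrent program $R$ with $R\|R\sqsubseteq_{\mathrm{sim}}R$. The quintuple $\{P\ R\}\,\mathcal{E}\,\{G\ Q\}$ is (by definition) the assertion $P\cdot(R\|\mathcal{E})\sqsubseteq Q$ and $\mathcal{E}\sqsubseteq_{\mathrm{sim}}G$. In the conclusion of the rule, $\{P\ R''\}\,\mathcal{E}\|\mathcal{E}'\,\{G\|G'\ Q\}$ means $P\cdot(R''\|(\mathcal{E}\|\mathcal{E}'))\sqsubseteq Q$ and $\mathcal{E}\|\mathcal{E}'\sqsubseteq_{\mathrm{sim}}G\|G'$.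
   Formalization: The formal rule additionally assumes that each component program ℰ and ℰ' can perform at least one event (the empty trace is not maximal); without this it fails, e.g. for ℰ'=0, since 0 is simulated by every structure. *)

theory Defs
  imports "HOL-Analysis.Analysis" "HOL-Library.Sublist"
begin

text \<open>The state space \<Omega> is the finite type \<^typ>\<open>'s\<close>; (sub)distributions are vectors in
  \<^typ>\<open>real^'s\<close>, so that convexity and closure are the library notions of Euclidean space.\<close>

section \<open>Programs\<close>

definition distributions :: "(real^'s::finite) set" where
  "distributions = {\<mu>. (\<forall>s. 0 \<le> \<mu> $ s) \<and> (\<Sum>s\<in>UNIV. \<mu> $ s) = 1}"

definition subdistributions :: "(real^'s::finite) set" where
  "subdistributions = {\<mu>. (\<forall>s. 0 \<le> \<mu> $ s) \<and> (\<Sum>s\<in>UNIV. \<mu> $ s) \<le> 1}"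

definition point :: "'s::finite \<Rightarrow> real^'s" where
  "point s = axis s 1"

definition programs :: "('s::finite \<Rightarrow> (real^'s) set) set" where
  "programs = {r. \<forall>s. r s \<subseteq> distributions \<and> r s \<noteq> {} \<and> convex (r s) \<and> closed (r s)}"

definition tests :: "('s::finite \<Rightarrow> (real^'s) set) set" where
  "tests = {b. \<forall>s. b s \<subseteq> {point s}}"

definition hle :: "('s::finite \<Rightarrow> (real^'s) set) \<Rightarrow> ('s \<Rightarrow> (real^'s) set) \<Rightarrow> bool"
    (infix "\<sqsubseteq>\<^sub>H" 50) where
  "r \<sqsubseteq>\<^sub>H r' \<longleftrightarrow> (\<forall>s. r s \<subseteq> r' s)"

definition skip :: "'s::finite \<Rightarrow> (real^'s) set" where
  "skip s = {point s}"


section \<open>Bundle event structures with internal probability\<close>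

text \<open>Events are a subset of a type; values of \<^term>\<open>label\<close> outside that subset are irrelevant.\<close>

record ('e, 's::finite) ipbes =
  events :: "'e set"
  bundles :: "('e set \<times> 'e) set"
  conflict :: "('e \<times> 'e) set"
  label :: "'e \<Rightarrow> 's \<Rightarrow> (real^'s) set"
  exits :: "'e set set"

definition set_conflict :: "('e, 's::finite) ipbes \<Rightarrow> 'e set \<Rightarrow> 'e set \<Rightarrow> bool" where
  "set_conflict \<E> x y \<longleftrightarrow> (\<forall>e\<in>x. \<forall>e'\<in>y. e \<noteq> e' \<longrightarrow> (e, e') \<in> conflict \<E>)"

definition is_ipbes :: "('e, 's::finite) ipbes \<Rightarrow> bool" where
  "is_ipbes \<E> \<longleftrightarrow>
     conflict \<E> \<subseteq> events \<E> \<times> events \<E> \<and> irrefl (conflict \<E>) \<and> sym (conflict \<E>) \<and>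
     bundles \<E> \<subseteq> Pow (events \<E>) \<times> events \<E> \<and>
     (\<forall>(x, e)\<in>bundles \<E>. set_conflict \<E> x x) \<and>
     (\<forall>e\<in>events \<E>. label \<E> e \<in> programs \<union> tests) \<and>
     exits \<E> \<subseteq> Pow (events \<E>) \<and> (\<forall>x\<in>exits \<E>. set_conflict \<E> x x)"

definition initial :: "('e, 's::finite) ipbes \<Rightarrow> 'e set" where
  "initial \<E> = {e \<in> events \<E>. \<forall>x. (x, e) \<notin> bundles \<E>}"


section \<open>Traces\<close>

definition traces :: "('e, 's::finite) ipbes \<Rightarrow> 'e list set" where
  "traces \<E> = {\<alpha>. set \<alpha> \<subseteq> events \<E> \<and> distinct \<alpha> \<and>
     (\<forall>e\<in>set \<alpha>. \<forall>e'\<in>set \<alpha>. (e, e') \<notin> conflict \<E>) \<and>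
     (\<forall>j<length \<alpha>. \<forall>x. (x, \<alpha> ! j) \<in> bundles \<E> \<longrightarrow> (\<exists>i<j. \<alpha> ! i \<in> x))}"

definition max_traces :: "('e, 's::finite) ipbes \<Rightarrow> 'e list set" where
  "max_traces \<E> = {\<alpha> \<in> traces \<E>. \<forall>\<beta>\<in>traces \<E>. prefix \<alpha> \<beta> \<longrightarrow> \<beta> = \<alpha>}"

definition enabled :: "('e, 's::finite) ipbes \<Rightarrow> 'e list \<Rightarrow> 'e set" where
  "enabled \<E> \<alpha> = {e. \<alpha> @ [e] \<in> traces \<E>}"

text \<open>The case \<^term>\<open>es = []\<close> covers maximal traces.\<close>

definition weakly_maximal :: "('e, 's::finite) ipbes \<Rightarrow> 'e list \<Rightarrow> bool" where
  "weakly_maximal \<E> \<alpha> \<longleftrightarrow> \<alpha> \<in> traces \<E> \<and>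
     (\<exists>es. \<alpha> @ es \<in> max_traces \<E> \<and> (\<forall>e\<in>set es. skip \<sqsubseteq>\<^sub>H label \<E> e))"


section \<open>Schedulers and semantics\<close>

text \<open>Partial functions \<open>\<sigma>(\<alpha>)\<close> are maps into the option type; values of \<open>\<sigma>\<close> at lists that
  are not traces are irrelevant.  The weights are summed with \<^const>\<open>has_sum\<close> because
  infinitely many events may be enabled.\<close>

type_synonym ('e, 's) scheduler = "'e list \<Rightarrow> ('e \<times> 's \<Rightarrow> (real^'s) option)"

definition is_scheduler :: "('e, 's::finite) ipbes \<Rightarrow> ('e, 's) scheduler \<Rightarrow> bool" where
  "is_scheduler \<E> \<sigma> \<longleftrightarrow> (\<forall>\<alpha>\<in>traces \<E>.
     dom (\<sigma> \<alpha>) = enabled \<E> \<alpha> \<times> UNIV \<and> ran (\<sigma> \<alpha>) \<subseteq> subdistributions \<and>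
     (\<exists>w :: 'e \<times> 's \<Rightarrow> real.
        (\<forall>e\<in>events \<E>. \<forall>s. 0 \<le> w (e, s) \<and> w (e, s) \<le> 1) \<and>
        (\<forall>e\<in>enabled \<E> \<alpha>. \<forall>s.
           (label \<E> e s \<noteq> {} \<longrightarrow> (\<exists>\<mu>\<in>label \<E> e s. \<sigma> \<alpha> (e, s) = Some (w (e, s) *\<^sub>R \<mu>))) \<and>
           (label \<E> e s = {} \<longrightarrow> w (e, s) = 0 \<and> \<sigma> \<alpha> (e, s) = Some 0)) \<and>
        (enabled \<E> \<alpha> \<noteq> {} \<longrightarrow> (\<forall>s. ((\<lambda>e. w (e, s)) has_sum 1) (enabled \<E> \<alpha>)))))"

text \<open>The recursion for \<open>\<phi>\<close> appends events at the end of a trace, so it is run on the reversed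
  list; the lemmas \<open>phi_Nil\<close> and \<open>phi_snoc\<close> are the intended equations.\<close>

primrec phi_rev :: "('e, 's::finite) scheduler \<Rightarrow> 's \<Rightarrow> 'e list \<Rightarrow> real^'s" where
  "phi_rev \<sigma> s [] = point s"
| "phi_rev \<sigma> s (e # \<alpha>) = (\<chi> u. \<Sum>t\<in>UNIV. the (\<sigma> (rev \<alpha>) (e, t)) $ u * phi_rev \<sigma> s \<alpha> $ t)"

definition phi :: "('e, 's::finite) scheduler \<Rightarrow> 's \<Rightarrow> 'e list \<Rightarrow> real^'s" where
  "phi \<sigma> s \<alpha> = phi_rev \<sigma> s (rev \<alpha>)"

lemma phi_Nil: "phi \<sigma> s [] = point s"
  by (simp add: phi_def)

lemma phi_snoc: "phi \<sigma> s (\<alpha> @ [e]) $ u = (\<Sum>t\<in>UNIV. the (\<sigma> \<alpha> (e, t)) $ u * phi \<sigma> s \<alpha> $ t)"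
  by (simp add: phi_def)

text \<open>For a scheduler, all summands are nonnegative and finite partial sums have total mass at
  most 1, so the infinite sum below always exists.\<close>

definition outcome :: "('e, 's::finite) ipbes \<Rightarrow> ('e, 's) scheduler \<Rightarrow> 's \<Rightarrow> real^'s" where
  "outcome \<E> \<sigma> s = (\<Sum>\<^sub>\<infinity>\<alpha>\<in>max_traces \<E>. phi \<sigma> s \<alpha>)"

definition Sched1 :: "('e, 's::finite) ipbes \<Rightarrow> ('e, 's) scheduler set" where
  "Sched1 \<E> = {\<sigma>. is_scheduler \<E> \<sigma> \<and> (\<forall>s. outcome \<E> \<sigma> s \<in> distributions)}"

definition feasible :: "('e, 's::finite) ipbes \<Rightarrow> bool" where
  "feasible \<E> \<longleftrightarrow>
     (\<forall>\<alpha>\<in>traces \<E> - max_traces \<E>. (\<Union>e\<in>enabled \<E> \<alpha>. {s. label \<E> e s \<noteq> {}}) = UNIV)"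

definition terminating :: "('e, 's::finite) ipbes \<Rightarrow> bool" where
  "terminating \<E> \<longleftrightarrow> Sched1 \<E> \<noteq> {}"

definition sem :: "('e, 's::finite) ipbes \<Rightarrow> 's \<Rightarrow> (real^'s) set" where
  "sem \<E> s = closure (convex hull {outcome \<E> \<sigma> s |\<sigma>. \<sigma> \<in> Sched1 \<E>})"

definition refines :: "('e, 's::finite) ipbes \<Rightarrow> ('f, 's) ipbes \<Rightarrow> bool" (infix "\<sqsubseteq>" 50) where
  "\<E> \<sqsubseteq> \<F> \<longleftrightarrow> sem \<E> \<sqsubseteq>\<^sub>H sem \<F>"

definition prob_conc_program :: "('e, 's::finite) ipbes \<Rightarrow> bool" where
  "prob_conc_program \<E> \<longleftrightarrow> is_ipbes \<E> \<and> feasible \<E> \<and> terminating \<E>"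


section \<open>Simulation\<close>

definition t_simulation ::
    "('e, 's::finite) ipbes \<Rightarrow> ('f, 's) ipbes \<Rightarrow> ('e list \<Rightarrow> 'f list) \<Rightarrow> bool" where
  "t_simulation \<E> \<F> f \<longleftrightarrow>
     f \<in> traces \<E> \<rightarrow> traces \<F> \<and>
     f [] = [] \<and> (\<forall>\<beta>\<in>traces \<F>. finite {\<alpha> \<in> traces \<E>. f \<alpha> = \<beta>}) \<and>
     (\<forall>\<alpha> e. \<alpha> @ [e] \<in> traces \<E> \<longrightarrow>
        f (\<alpha> @ [e]) = f \<alpha> \<and> label \<E> e \<sqsubseteq>\<^sub>H skip \<or>
        (\<exists>e'\<in>events \<F>. label \<E> e \<sqsubseteq>\<^sub>H label \<F> e' \<and> f (\<alpha> @ [e]) = f \<alpha> @ [e'])) \<and>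
     (\<forall>\<alpha> e. \<alpha> @ [e] \<in> max_traces \<E> \<longrightarrow>
        (\<exists>e'\<in>events \<F>. label \<E> e \<sqsubseteq>\<^sub>H label \<F> e' \<and> f (\<alpha> @ [e]) = f \<alpha> @ [e']) \<and>
        weakly_maximal \<F> (f (\<alpha> @ [e])))"

definition sim :: "('e, 's::finite) ipbes \<Rightarrow> ('f, 's) ipbes \<Rightarrow> bool" (infix "\<sqsubseteq>\<^sub>s\<^sub>i\<^sub>m" 50) where
  "\<E> \<sqsubseteq>\<^sub>s\<^sub>i\<^sub>m \<F> \<longleftrightarrow> (\<exists>f. t_simulation \<E> \<F> f)"


section \<open>Operations\<close>

text \<open>Disjointness of the event sets is obtained by tagging with \<^const>\<open>Inl\<close> and \<^const>\<open>Inr\<close>.\<close>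

definition copy_bundles :: "('e \<Rightarrow> 'f) \<Rightarrow> ('e, 's::finite) ipbes \<Rightarrow> ('f set \<times> 'f) set" where
  "copy_bundles h \<E> = {(h ` x, h e) |x e. (x, e) \<in> bundles \<E>}"

definition copy_conflict :: "('e \<Rightarrow> 'f) \<Rightarrow> ('e, 's::finite) ipbes \<Rightarrow> ('f \<times> 'f) set" where
  "copy_conflict h \<E> = {(h e, h e') |e e'. (e, e') \<in> conflict \<E>}"

definition copy_exits :: "('e \<Rightarrow> 'f) \<Rightarrow> ('e, 's::finite) ipbes \<Rightarrow> 'f set set" where
  "copy_exits h \<E> = {h ` x |x. x \<in> exits \<E>}"

definition is_zero :: "('e, 's::finite) ipbes \<Rightarrow> bool" where
  "is_zero \<E> \<longleftrightarrow> is_ipbes \<E> \<and> events \<E> = {} \<and> exits \<E> = {}"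

text \<open>The general formula for \<open>\<E> \<cdot> \<F>\<close> already yields a copy of \<open>\<F>\<close> if \<open>\<E>\<close> is \<open>0\<close>, and a copy of
  \<open>\<E>\<close> except for the exit sets if \<open>\<F>\<close> is \<open>0\<close>.  Hence only the exit sets need a case distinction
  to implement the convention \<open>0 \<cdot> \<E> = \<E> \<cdot> 0 = \<E>\<close>.\<close>

definition seq_comp :: "('e, 's::finite) ipbes \<Rightarrow> ('f, 's) ipbes \<Rightarrow> ('e + 'f, 's) ipbes"
    (infixr "\<odot>" 75) where
  "\<E> \<odot> \<F> = \<lparr>
     events = Inl ` events \<E> \<union> Inr ` events \<F>,
     bundles = copy_bundles Inl \<E> \<union> copy_bundles Inr \<F> \<union>
       {(Inl ` x, Inr e) |x e. x \<in> exits \<E> \<and> e \<in> initial \<F>},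
     conflict = copy_conflict Inl \<E> \<union> copy_conflict Inr \<F>,
     label = case_sum (label \<E>) (label \<F>),
     exits = (if is_zero \<F> then copy_exits Inl \<E> else copy_exits Inr \<F>)\<rparr>"

definition par_comp :: "('e, 's::finite) ipbes \<Rightarrow> ('f, 's) ipbes \<Rightarrow> ('e + 'f, 's) ipbes"
    (infixr "\<parallel>\<^sub>p" 70) where
  "\<E> \<parallel>\<^sub>p \<F> = \<lparr>
     events = Inl ` events \<E> \<union> Inr ` events \<F>,
     bundles = copy_bundles Inl \<E> \<union> copy_bundles Inr \<F>,
     conflict = copy_conflict Inl \<E> \<union> copy_conflict Inr \<F>,
     label = case_sum (label \<E>) (label \<F>),
     exits = copy_exits Inl \<E> \<union> copy_exits Inr \<F>\<rparr>"


section \<open>Rely-guarantee\<close>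

definition rg_condition :: "('e, 's::finite) ipbes \<Rightarrow> bool" where
  "rg_condition R \<longleftrightarrow> prob_conc_program R \<and> R \<parallel>\<^sub>p R \<sqsubseteq>\<^sub>s\<^sub>i\<^sub>m R"

definition quintuple ::
    "('p, 's::finite) ipbes \<Rightarrow> ('r, 's) ipbes \<Rightarrow> ('e, 's) ipbes \<Rightarrow> ('g, 's) ipbes \<Rightarrow>
     ('q, 's) ipbes \<Rightarrow> bool" where
  "quintuple P R \<E> G Q \<longleftrightarrow> P \<odot> (R \<parallel>\<^sub>p \<E>) \<sqsubseteq> Q \<and> \<E> \<sqsubseteq>\<^sub>s\<^sub>i\<^sub>m G"

end

theory Submission
  imports Defs
begin

text \<open>Simulations compose, and they are preserved by \<open>\<parallel>\<close> and by \<open>P \<cdot> _\<close>, provided that weak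
  maximality is also required of the image of a maximal empty trace.  Hence \<open>R'' \<parallel> (\<E> \<parallel> \<E>')\<close> is
  simulated by \<open>R \<parallel> (\<E> \<parallel> R)\<close>, and this by \<open>R \<parallel> \<E>\<close> because \<open>R \<parallel> R\<close> is simulated by \<open>R\<close>.  If the
  empty trace is maximal in \<open>R''\<close>, then \<open>R''\<close> is inert and can be dropped instead.  It remains to see that simulation implies refinement.  A scheduler moves mass along
  the traces of \<open>\<E>\<close>; pushing this flow forward along a simulation \<open>f\<close> and letting the mass that
  has stopped at a maximal trace \<open>\<alpha>\<close> pass from \<open>f \<alpha>\<close> to a maximal trace through events above
  \<open>skip\<close> gives a flow on \<open>\<F>\<close>, and normalising that flow gives a scheduler.\<close>

section \<open>Traces\<close>

text \<open>A scheduler cannot be transported event by event. Several traces of \<E> may share one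
  image in \<F>, and the proportions in which they carry mass depend on the initial state, whereas a
  scheduler on \<F> sees only the image and has to serve all initial states. The normalised flow
  therefore reproduces its source only for one fixed mixture of initial states, while
  \<open>Sched1\<close> asks for termination from each of them. A mixture of full support settles
  termination; one concentrated near a single state gives the outcome from that state up to an
  error, which the closure in \<open>sem\<close> absorbs. Finite fibres make the sums over preimages
  meaningful although infinitely many events may be enabled. Flows that meet in one event of \<F>
  add up inside its label because labels are convex. Feasibility of \<F> serves at states that carry
  no mass, where normalising prescribes nothing.\<close>

lemma Nil_in_traces [simp]: "[] \<in> traces \<E>"
  by (simp add: traces_def)

text \<open>Replaces positions by a condition on the last event, the form in which all inductions on
  traces run. Well-formedness of \<E> is not assumed, so both orientations of a conflict and the
  pair \<open>(e, e)\<close> appear.\<close>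

lemma traces_snoc:
  "\<alpha> @ [e] \<in> traces \<E> \<longleftrightarrow> \<alpha> \<in> traces \<E> \<and> e \<in> events \<E> \<and> e \<notin> set \<alpha> \<and> (e, e) \<notin> conflict \<E> \<and>
     (\<forall>a\<in>set \<alpha>. (e, a) \<notin> conflict \<E> \<and> (a, e) \<notin> conflict \<E>) \<and>
     (\<forall>x. (x, e) \<in> bundles \<E> \<longrightarrow> set \<alpha> \<inter> x \<noteq> {})"
proof -
  let ?ok = "\<lambda>\<gamma> j. \<forall>x. (x, \<gamma> ! j) \<in> bundles \<E> \<longrightarrow> (\<exists>i<j. \<gamma> ! i \<in> x)"
  have "?ok (\<alpha> @ [e]) j \<longleftrightarrow> ?ok \<alpha> j" if "j < length \<alpha>" for j
  proof -
    have "(\<alpha> @ [e]) ! i = \<alpha> ! i" if "i \<le> j" for i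
      using that \<open>j < length \<alpha>\<close> by (simp add: nth_append)
    then show ?thesis
      by (metis order_less_imp_le order_refl)
  qed
  moreover have "?ok (\<alpha> @ [e]) (length \<alpha>) \<longleftrightarrow> (\<forall>x. (x, e) \<in> bundles \<E> \<longrightarrow> set \<alpha> \<inter> x \<noteq> {})"
  proof -
    have "(\<exists>i<length \<alpha>. (\<alpha> @ [e]) ! i \<in> x) \<longleftrightarrow> set \<alpha> \<inter> x \<noteq> {}" for x
      unfolding disjoint_iff in_set_conv_nth by (metis nth_append)
    then show ?thesis
      by simp
  qed
  moreover have "(\<forall>j<length (\<alpha> @ [e]). ?ok (\<alpha> @ [e]) j) \<longleftrightarrow>
      (\<forall>j<length \<alpha>. ?ok (\<alpha> @ [e]) j) \<and> ?ok (\<alpha> @ [e]) (length \<alpha>)"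
    unfolding length_append_singleton All_less_Suc by (rule conj_commute)
  ultimately have "(\<forall>j<length (\<alpha> @ [e]). ?ok (\<alpha> @ [e]) j) \<longleftrightarrow>
      (\<forall>j<length \<alpha>. ?ok \<alpha> j) \<and> (\<forall>x. (x, e) \<in> bundles \<E> \<longrightarrow> set \<alpha> \<inter> x \<noteq> {})"
    by presburger
  then show ?thesis
    unfolding traces_def mem_Collect_eq by auto
qed

lemma traces_appendD: "\<alpha> @ \<beta> \<in> traces \<E> \<Longrightarrow> \<alpha> \<in> traces \<E>"
proof (induction \<beta> rule: rev_induct)
  case (snoc e \<beta>)
  then show ?case
    using traces_snoc[of "\<alpha> @ \<beta>" e \<E>] by simp
qed simp

lemma traces_snocD: "\<alpha> @ [e] \<in> traces \<E> \<Longrightarrow> \<alpha> \<in> traces \<E>" "\<alpha> @ [e] \<in> traces \<E> \<Longrightarrow> e \<in> events \<E>"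
  by (simp_all add: traces_snoc)

text \<open>Traces are closed under prefixes, so a proper extension already yields an extension by
  its first new event.\<close>

lemma max_traces_iff: "\<alpha> \<in> max_traces \<E> \<longleftrightarrow> \<alpha> \<in> traces \<E> \<and> (\<forall>e. \<alpha> @ [e] \<notin> traces \<E>)"
proof
  assume "\<alpha> \<in> traces \<E> \<and> (\<forall>e. \<alpha> @ [e] \<notin> traces \<E>)"
  moreover have "\<alpha> @ \<gamma> \<in> traces \<E> \<Longrightarrow> \<gamma> \<noteq> [] \<Longrightarrow> \<exists>e. \<alpha> @ [e] \<in> traces \<E>" for \<gamma>
    by (cases \<gamma>) (auto dest: traces_appendD[of "\<alpha> @ [_]", simplified])
  ultimately show "\<alpha> \<in> max_traces \<E>"
    by (auto simp: max_traces_def prefix_def)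
qed (auto simp: max_traces_def)

lemma max_traces_subset: "\<alpha> \<in> max_traces \<E> \<Longrightarrow> \<alpha> \<in> traces \<E>"
  by (simp add: max_traces_def)

lemma max_traces_prefixD: "\<alpha> \<in> max_traces \<E> \<Longrightarrow> \<beta> \<in> traces \<E> \<Longrightarrow> prefix \<alpha> \<beta> \<Longrightarrow> \<beta> = \<alpha>"
  by (simp add: max_traces_def)

lemma enabled_max: "\<alpha> \<in> max_traces \<E> \<Longrightarrow> enabled \<E> \<alpha> = {}"
  by (simp add: enabled_def max_traces_iff)

lemma max_weakly_maximal: "\<alpha> \<in> max_traces \<E> \<Longrightarrow> weakly_maximal \<E> \<alpha>"
  unfolding weakly_maximal_def by (auto simp: max_traces_subset intro!: exI[of _ "[]"])


section \<open>Complete simulations\<close>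

text \<open>Clause (iii) of a t-simulation says nothing about a maximal empty trace.  Requiring weak
  maximality there as well makes simulations compatible with the product constructions
  without side conditions.\<close>

definition complete_t_simulation ::
    "('e, 's::finite) ipbes \<Rightarrow> ('f, 's) ipbes \<Rightarrow> ('e list \<Rightarrow> 'f list) \<Rightarrow> bool" where
  "complete_t_simulation \<E> \<F> f \<longleftrightarrow>
     t_simulation \<E> \<F> f \<and> (\<forall>\<alpha>\<in>max_traces \<E>. weakly_maximal \<F> (f \<alpha>))"

definition complete_sim :: "('e, 's::finite) ipbes \<Rightarrow> ('f, 's) ipbes \<Rightarrow> bool"
    (infix "\<sqsubseteq>\<^sub>c" 50) where
  "\<E> \<sqsubseteq>\<^sub>c \<F> \<longleftrightarrow> (\<exists>f. complete_t_simulation \<E> \<F> f)"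

lemma complete_sim_imp_sim: "\<E> \<sqsubseteq>\<^sub>c \<F> \<Longrightarrow> \<E> \<sqsubseteq>\<^sub>s\<^sub>i\<^sub>m \<F>"
  unfolding complete_sim_def complete_t_simulation_def sim_def by blast

lemma complete_simI:
  assumes "\<And>\<alpha>. \<alpha> \<in> traces \<E> \<Longrightarrow> f \<alpha> \<in> traces \<F>"
    and "f [] = []"
    and "\<And>\<beta>. \<beta> \<in> traces \<F> \<Longrightarrow> finite {\<alpha> \<in> traces \<E>. f \<alpha> = \<beta>}"
    and "\<And>\<alpha> e. \<alpha> @ [e] \<in> traces \<E> \<Longrightarrow>
        f (\<alpha> @ [e]) = f \<alpha> \<and> label \<E> e \<sqsubseteq>\<^sub>H skip \<or>
        (\<exists>e'\<in>events \<F>. label \<E> e \<sqsubseteq>\<^sub>H label \<F> e' \<and> f (\<alpha> @ [e]) = f \<alpha> @ [e'])"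
    and "\<And>\<alpha> e. \<alpha> @ [e] \<in> max_traces \<E> \<Longrightarrow>
        (\<exists>e'\<in>events \<F>. label \<E> e \<sqsubseteq>\<^sub>H label \<F> e' \<and> f (\<alpha> @ [e]) = f \<alpha> @ [e'])"
    and "\<And>\<alpha>. \<alpha> \<in> max_traces \<E> \<Longrightarrow> weakly_maximal \<F> (f \<alpha>)"
  shows "\<E> \<sqsubseteq>\<^sub>c \<F>"
  unfolding complete_sim_def complete_t_simulation_def t_simulation_def using assms by blast

lemma complete_t_simulationD:
  assumes "complete_t_simulation \<E> \<F> f"
  shows "\<alpha> \<in> traces \<E> \<Longrightarrow> f \<alpha> \<in> traces \<F>"
    and "f [] = []"
    and "\<beta> \<in> traces \<F> \<Longrightarrow> finite {\<alpha> \<in> traces \<E>. f \<alpha> = \<beta>}"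
    and "\<alpha> @ [e] \<in> traces \<E> \<Longrightarrow>
        f (\<alpha> @ [e]) = f \<alpha> \<and> label \<E> e \<sqsubseteq>\<^sub>H skip \<or>
        (\<exists>e'\<in>events \<F>. label \<E> e \<sqsubseteq>\<^sub>H label \<F> e' \<and> f (\<alpha> @ [e]) = f \<alpha> @ [e'])"
    and "\<alpha> @ [e] \<in> max_traces \<E> \<Longrightarrow>
        \<exists>e'\<in>events \<F>. label \<E> e \<sqsubseteq>\<^sub>H label \<F> e' \<and> f (\<alpha> @ [e]) = f \<alpha> @ [e']"
    and "\<alpha> \<in> max_traces \<E> \<Longrightarrow> weakly_maximal \<F> (f \<alpha>)"
  using assms unfolding complete_t_simulation_def t_simulation_def by blast+

lemma sim_imp_complete_sim:
  assumes "\<E> \<sqsubseteq>\<^sub>s\<^sub>i\<^sub>m \<F>" and "[] \<in> max_traces \<E> \<Longrightarrow> weakly_maximal \<F> []"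
  shows "\<E> \<sqsubseteq>\<^sub>c \<F>"
proof -
  obtain f where f: "t_simulation \<E> \<F> f"
    using assms(1) by (auto simp: sim_def)
  have "weakly_maximal \<F> (f \<alpha>)" if "\<alpha> \<in> max_traces \<E>" for \<alpha>
  proof (cases \<alpha> rule: rev_cases)
    case Nil
    then show ?thesis
      using f assms(2) that by (simp add: t_simulation_def)
  next
    case (snoc \<beta> e)
    then show ?thesis
      using f that unfolding t_simulation_def by blast
  qed
  then show ?thesis
    using f unfolding complete_sim_def complete_t_simulation_def by blast
qed

lemma hle_trans: "a \<sqsubseteq>\<^sub>H b \<Longrightarrow> b \<sqsubseteq>\<^sub>H c \<Longrightarrow> a \<sqsubseteq>\<^sub>H c"
  unfolding hle_def by blast

lemma hle_refl [simp]: "a \<sqsubseteq>\<^sub>H a"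
  by (simp add: hle_def)

text \<open>Each event of \<open>es\<close> is either forgotten by \<open>g\<close> or sent to an
  event with a larger label, which is then again above \<open>skip\<close>.\<close>

lemma complete_t_simulation_append:
  assumes g: "complete_t_simulation \<F> \<H> g" and tr: "\<beta> @ es \<in> traces \<F>"
    and sk: "\<forall>e\<in>set es. skip \<sqsubseteq>\<^sub>H label \<F> e"
  shows "\<exists>es'. g (\<beta> @ es) = g \<beta> @ es' \<and> (\<forall>e\<in>set es'. skip \<sqsubseteq>\<^sub>H label \<H> e \<and> e \<in> events \<H>)"
  using tr sk
proof (induction es rule: rev_induct)
  case (snoc e es)
  have tr: "(\<beta> @ es) @ [e] \<in> traces \<F>"
    using snoc.prems by simp
  then obtain es' where es': "g (\<beta> @ es) = g \<beta> @ es'"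
    "\<forall>e\<in>set es'. skip \<sqsubseteq>\<^sub>H label \<H> e \<and> e \<in> events \<H>"
    using snoc by (metis UnCI set_append traces_snocD(1))
  have sk: "skip \<sqsubseteq>\<^sub>H label \<F> e"
    using snoc.prems by simp
  from complete_t_simulationD(4)[OF g tr] show ?case
  proof
    assume "\<exists>e'\<in>events \<H>. label \<F> e \<sqsubseteq>\<^sub>H label \<H> e' \<and> g ((\<beta> @ es) @ [e]) = g (\<beta> @ es) @ [e']"
    then obtain e' where "e' \<in> events \<H>" "label \<F> e \<sqsubseteq>\<^sub>H label \<H> e'"
      "g ((\<beta> @ es) @ [e]) = g (\<beta> @ es) @ [e']" by blast
    with es' sk show ?case
      by (intro exI[of _ "es' @ [e']"]) (auto intro: hle_trans)
  qed (use es' in auto)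
qed auto

text \<open>The image of the completing block, followed by a completion of the image of the
  completed trace, completes \<open>g \<beta>\<close>.\<close>

lemma complete_t_simulation_weakly_maximal:
  assumes g: "complete_t_simulation \<F> \<H> g" and "weakly_maximal \<F> \<beta>"
  shows "weakly_maximal \<H> (g \<beta>)"
proof -
  obtain es where es: "\<beta> @ es \<in> max_traces \<F>" "\<forall>e\<in>set es. skip \<sqsubseteq>\<^sub>H label \<F> e" "\<beta> \<in> traces \<F>"
    using assms(2) by (auto simp: weakly_maximal_def)
  obtain es' where es': "g (\<beta> @ es) = g \<beta> @ es'" "\<forall>e\<in>set es'. skip \<sqsubseteq>\<^sub>H label \<H> e \<and> e \<in> events \<H>"
    using complete_t_simulation_append[OF g max_traces_subset[OF es(1)] es(2)] by blast
  have "weakly_maximal \<H> (g \<beta> @ es')"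
    using complete_t_simulationD(6)[OF g es(1)] es' by simp
  then obtain fs where "(g \<beta> @ es') @ fs \<in> max_traces \<H>" "\<forall>e\<in>set fs. skip \<sqsubseteq>\<^sub>H label \<H> e"
    by (auto simp: weakly_maximal_def)
  then show ?thesis
    using es' complete_t_simulationD(1)[OF g es(3)] unfolding weakly_maximal_def
    by (auto intro!: exI[of _ "es' @ fs"])
qed

text \<open>The composite of two simulations may forget the last event \<open>e\<close> of a maximal trace,
  namely when its image \<open>e'\<close> is followed only by events above \<open>skip\<close>.  The first of these
  that survives is an admissible image of \<open>e\<close>, since then \<open>\<lambda>(e) \<sqsubseteq> \<lambda>(e') \<sqsubseteq> skip\<close>.  Redirecting the
  composite at maximal traces has no effect on other traces.\<close>

lemma complete_sim_trans [trans]: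
  assumes "\<E> \<sqsubseteq>\<^sub>c \<F>" "\<F> \<sqsubseteq>\<^sub>c \<H>"
  shows "\<E> \<sqsubseteq>\<^sub>c \<H>"
proof -
  obtain f g where f: "complete_t_simulation \<E> \<F> f" and g: "complete_t_simulation \<F> \<H> g"
    using assms by (auto simp: complete_sim_def)
  note fD = complete_t_simulationD[OF f] and gD = complete_t_simulationD[OF g]
  define h where "h = g \<circ> f"
  have h_wm: "weakly_maximal \<H> (h \<alpha>)" if "\<alpha> \<in> max_traces \<E>" for \<alpha>
    using complete_t_simulation_weakly_maximal[OF g fD(6)[OF that]] by (simp add: h_def)
  have h_step: "h (\<alpha> @ [e]) = h \<alpha> \<and> label \<E> e \<sqsubseteq>\<^sub>H skip \<or>
      (\<exists>e'\<in>events \<H>. label \<E> e \<sqsubseteq>\<^sub>H label \<H> e' \<and> h (\<alpha> @ [e]) = h \<alpha> @ [e'])"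
    if tr: "\<alpha> @ [e] \<in> traces \<E>" for \<alpha> e
    using fD(4)[OF tr]
  proof
    assume "\<exists>e'\<in>events \<F>. label \<E> e \<sqsubseteq>\<^sub>H label \<F> e' \<and> f (\<alpha> @ [e]) = f \<alpha> @ [e']"
    then obtain e' where e': "label \<E> e \<sqsubseteq>\<^sub>H label \<F> e'" "f (\<alpha> @ [e]) = f \<alpha> @ [e']" by blast
    then have "f \<alpha> @ [e'] \<in> traces \<F>"
      using fD(1)[OF tr] by simp
    from gD(4)[OF this] e' show ?thesis
      unfolding h_def comp_def by (metis hle_trans)
  qed (simp add: h_def)
  have repair: "\<exists>e'\<in>events \<H>. label \<E> e \<sqsubseteq>\<^sub>H label \<H> e' \<and> weakly_maximal \<H> (h \<alpha> @ [e'])"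
    if mx: "\<alpha> @ [e] \<in> max_traces \<E>" for \<alpha> e
  proof -
    have tr: "\<alpha> @ [e] \<in> traces \<E>"
      using mx by (rule max_traces_subset)
    show ?thesis
    proof (cases "\<exists>e'\<in>events \<H>. label \<E> e \<sqsubseteq>\<^sub>H label \<H> e' \<and> h (\<alpha> @ [e]) = h \<alpha> @ [e']")
      case True
      then show ?thesis
        using h_wm[OF mx] by auto
    next
      case False
      then have col: "h (\<alpha> @ [e]) = h \<alpha>" "label \<E> e \<sqsubseteq>\<^sub>H skip"
        using h_step[OF tr] by auto
      obtain e' where e': "f (\<alpha> @ [e]) = f \<alpha> @ [e']"
        using fD(5)[OF mx] by blast
      obtain es where es: "f (\<alpha> @ [e]) @ es \<in> max_traces \<F>" "\<forall>e\<in>set es. skip \<sqsubseteq>\<^sub>H label \<F> e"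
        using fD(6)[OF mx] by (auto simp: weakly_maximal_def)
      obtain es' where es': "g (f (\<alpha> @ [e]) @ es) = g (f (\<alpha> @ [e])) @ es'"
        "\<forall>e\<in>set es'. skip \<sqsubseteq>\<^sub>H label \<H> e \<and> e \<in> events \<H>"
        using complete_t_simulation_append[OF g max_traces_subset[OF es(1)] es(2)] by blast
      have es'_eq: "g (f (\<alpha> @ [e]) @ es) = h \<alpha> @ es'"
        using es'(1) col(1) by (simp add: h_def)
      \<comment> \<open>The completed trace is maximal in \<F> and not empty, so \<open>g\<close>
        must append an event for its last element. That element is \<open>e'\<close> or the last of
        \<open>es\<close>; in both cases the image properly extends
        \<open>h \<alpha>\<close>.\<close>
      have "es' \<noteq> []"
      proof
        assume "es' = []"
        then have eq: "g (f (\<alpha> @ [e]) @ es) = h \<alpha>"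
          using es'_eq by simp
        show False
        proof (cases es rule: rev_cases)
          case Nil
          then have "f \<alpha> @ [e'] \<in> max_traces \<F>"
            using es(1) e' by simp
          from gD(5)[OF this] eq Nil e' show False
            by (auto simp: h_def)
        next
          case (snoc fs a)
          then have "(f (\<alpha> @ [e]) @ fs) @ [a] \<in> max_traces \<F>"
            using es(1) by simp
          from gD(5)[OF this] obtain b where "g (f (\<alpha> @ [e]) @ es) = g (f (\<alpha> @ [e]) @ fs) @ [b]"
            using snoc by auto
          moreover have "f (\<alpha> @ [e]) @ fs \<in> traces \<F>" "\<forall>e\<in>set fs. skip \<sqsubseteq>\<^sub>H label \<F> e"
            using es snoc max_traces_subset traces_appendD[of "f (\<alpha> @ [e]) @ fs" "[a]"] by auto
          then obtain bs where "g (f (\<alpha> @ [e]) @ fs) = g (f (\<alpha> @ [e])) @ bs"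
            using complete_t_simulation_append[OF g] by blast
          ultimately show False
            using eq col(1) by (simp add: h_def)
        qed
      qed
      then obtain b bs where b: "es' = b # bs"
        by (cases es') auto
      have "weakly_maximal \<H> (h \<alpha> @ es')"
        using gD(6)[OF es(1)] es'_eq by simp
      then obtain fs where fs: "(h \<alpha> @ es') @ fs \<in> max_traces \<H>" "\<forall>e\<in>set fs. skip \<sqsubseteq>\<^sub>H label \<H> e"
        by (auto simp: weakly_maximal_def)
      have "(h \<alpha> @ [b]) @ bs @ fs \<in> max_traces \<H>"
        using fs b by simp
      moreover from this have "h \<alpha> @ [b] \<in> traces \<H>"
        by (rule traces_appendD[OF max_traces_subset])
      ultimately have "weakly_maximal \<H> (h \<alpha> @ [b])"
        using fs es' b unfolding weakly_maximal_def by (auto intro!: exI[of _ "bs @ fs"])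
      then show ?thesis
        using es'(2) b col(2) by (auto intro!: bexI[of _ b] intro: hle_trans)
    qed
  qed
  define p where "p \<alpha> e = (SOME e'. e' \<in> events \<H> \<and> label \<E> e \<sqsubseteq>\<^sub>H label \<H> e' \<and>
      weakly_maximal \<H> (h \<alpha> @ [e']))" for \<alpha> e
  have p: "p \<alpha> e \<in> events \<H>" "label \<E> e \<sqsubseteq>\<^sub>H label \<H> (p \<alpha> e)" "weakly_maximal \<H> (h \<alpha> @ [p \<alpha> e])"
    if "\<alpha> @ [e] \<in> max_traces \<E>" for \<alpha> e
    using someI_ex[of "\<lambda>e'. e' \<in> events \<H> \<and> label \<E> e \<sqsubseteq>\<^sub>H label \<H> e' \<and> weakly_maximal \<H> (h \<alpha> @ [e'])"]
      repair[OF that] unfolding p_def by blast+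
  define k where "k \<alpha> = (if \<alpha> \<in> max_traces \<E> \<and> \<alpha> \<noteq> [] \<and> h \<alpha> = h (butlast \<alpha>)
      then h \<alpha> @ [p (butlast \<alpha>) (last \<alpha>)] else h \<alpha>)" for \<alpha>
  have k_max: "\<exists>e'\<in>events \<H>. label \<E> e \<sqsubseteq>\<^sub>H label \<H> e' \<and> k (\<alpha> @ [e]) = h \<alpha> @ [e']"
    if "\<alpha> @ [e] \<in> max_traces \<E>" for \<alpha> e
    using h_step[OF max_traces_subset[OF that]] that p[OF that] by (auto simp: k_def)
  have k_nonmax: "k \<alpha> = h \<alpha>" if "\<alpha> @ [e] \<in> traces \<E>" for \<alpha> e
    using that by (auto simp: k_def max_traces_iff)
  have k_wm: "weakly_maximal \<H> (k \<alpha>)" if "\<alpha> \<in> max_traces \<E>" for \<alpha>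
    using that h_wm[OF that] p(3)[of "butlast \<alpha>" "last \<alpha>"] by (auto simp: k_def)
  have h_traces: "h \<alpha> \<in> traces \<H>" if "\<alpha> \<in> traces \<E>" for \<alpha>
    using that fD(1) gD(1) by (simp add: h_def)
  have h_fin: "finite {\<alpha> \<in> traces \<E>. h \<alpha> = \<beta>}" if "\<beta> \<in> traces \<H>" for \<beta>
  proof -
    have "{\<alpha> \<in> traces \<E>. h \<alpha> = \<beta>} \<subseteq> (\<Union>\<gamma>\<in>{\<gamma>\<in>traces \<F>. g \<gamma> = \<beta>}. {\<alpha> \<in> traces \<E>. f \<alpha> = \<gamma>})"
      using fD(1) by (auto simp: h_def)
    moreover have "finite \<dots>"
      using gD(3)[OF that] fD(3) by auto
    ultimately show ?thesis
      by (rule finite_subset)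
  qed
  show ?thesis
  proof (rule complete_simI[where f = k])
    show "k \<alpha> \<in> traces \<H>" if "\<alpha> \<in> traces \<E>" for \<alpha>
      using h_traces[OF that] k_wm[of \<alpha>] by (cases "\<alpha> \<in> max_traces \<E>") (auto simp: weakly_maximal_def k_def)
    show "k [] = []"
      using fD(2) gD(2) by (simp add: k_def h_def)
    show "finite {\<alpha> \<in> traces \<E>. k \<alpha> = \<beta>}" if "\<beta> \<in> traces \<H>" for \<beta>
    proof -
      \<comment> \<open>The redirection adds exactly one event, so each trace sent to \<beta> by
        \<open>k\<close> is sent by \<open>h\<close> to \<beta> or to
        \<open>butlast \<beta>\<close>; for empty \<beta> the two agree.\<close>
      have "butlast \<beta> \<in> traces \<H>"
        using that traces_appendD[of "butlast \<beta>" "[last \<beta>]"] by (cases "\<beta> = []") auto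
      then have "finite ({\<alpha> \<in> traces \<E>. h \<alpha> = butlast \<beta>} \<union> {\<alpha> \<in> traces \<E>. h \<alpha> = \<beta>})"
        using h_fin that by auto
      then show ?thesis
        by (rule rev_finite_subset) (auto simp: k_def split: if_splits)
    qed
    show "k (\<alpha> @ [e]) = k \<alpha> \<and> label \<E> e \<sqsubseteq>\<^sub>H skip \<or>
        (\<exists>e'\<in>events \<H>. label \<E> e \<sqsubseteq>\<^sub>H label \<H> e' \<and> k (\<alpha> @ [e]) = k \<alpha> @ [e'])"
      if "\<alpha> @ [e] \<in> traces \<E>" for \<alpha> e
    proof (cases "\<alpha> @ [e] \<in> max_traces \<E>")
      case True
      then show ?thesis
        using k_max k_nonmax[OF that] by metis
    next
      case False
      then have "k (\<alpha> @ [e]) = h (\<alpha> @ [e])"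
        by (simp add: k_def)
      then show ?thesis
        using h_step[OF that] k_nonmax[OF that] by simp
    qed
    show "\<exists>e'\<in>events \<H>. label \<E> e \<sqsubseteq>\<^sub>H label \<H> e' \<and> k (\<alpha> @ [e]) = k \<alpha> @ [e']"
      if "\<alpha> @ [e] \<in> max_traces \<E>" for \<alpha> e
      using k_max[OF that] k_nonmax[OF max_traces_subset[OF that]] by metis
    show "weakly_maximal \<H> (k \<alpha>)" if "\<alpha> \<in> max_traces \<E>" for \<alpha>
      using k_wm[OF that] .
  qed
qed


section \<open>Guarded products\<close>

primrec lefts :: "('a + 'b) list \<Rightarrow> 'a list" where
  "lefts [] = []"
| "lefts (x # xs) = (case x of Inl a \<Rightarrow> a # lefts xs | Inr b \<Rightarrow> lefts xs)"

primrec rights :: "('a + 'b) list \<Rightarrow> 'b list" where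
  "rights [] = []"
| "rights (x # xs) = (case x of Inl a \<Rightarrow> rights xs | Inr b \<Rightarrow> b # rights xs)"

lemma lefts_append [simp]: "lefts (xs @ ys) = lefts xs @ lefts ys"
  by (induction xs) (auto split: sum.split)

lemma rights_append [simp]: "rights (xs @ ys) = rights xs @ rights ys"
  by (induction xs) (auto split: sum.split)

lemma lefts_map_Inr [simp]: "lefts (map Inr xs) = []"
  by (induction xs) auto

lemma rights_map_Inr [simp]: "rights (map Inr xs) = xs"
  by (induction xs) auto

lemma set_lefts [simp]: "set (lefts xs) = {a. Inl a \<in> set xs}"
  by (induction xs) (auto split: sum.splits)

lemma set_rights [simp]: "set (rights xs) = {b. Inr b \<in> set xs}"
  by (induction xs) (auto split: sum.splits)

lemma set_lefts_rights: "set xs = Inl ` set (lefts xs) \<union> Inr ` set (rights xs)"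
proof (intro set_eqI iffI)
  show "x \<in> Inl ` set (lefts xs) \<union> Inr ` set (rights xs)" if "x \<in> set xs" for x
    by (cases x) (use that in auto)
qed auto

lemma length_lefts_rights: "length xs = length (lefts xs) + length (rights xs)"
  by (induction xs) (auto split: sum.splits)

text \<open>The two projections determine the length and the set of entries of an
  interleaving.\<close>

lemma finite_interleavings: "finite {xs. lefts xs = as \<and> rights xs = bs}"
proof (rule finite_subset)
  show "{xs. lefts xs = as \<and> rights xs = bs} \<subseteq>
      {xs. set xs \<subseteq> Inl ` set as \<union> Inr ` set bs \<and> length xs = length as + length bs}"
    using set_lefts_rights length_lefts_rights by blast
qed (simp add: finite_lists_length_eq)

section \<open>Guards on the right component\<close>

definition meets :: "'a set set \<Rightarrow> 'a list \<Rightarrow> bool" where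
  "meets X \<alpha> \<longleftrightarrow> (\<forall>x\<in>X. set \<alpha> \<inter> x \<noteq> {})"

definition guarded :: "'a set set \<Rightarrow> ('a + 'b) list \<Rightarrow> bool" where
  "guarded X \<gamma> \<longleftrightarrow> (\<forall>\<beta> b \<delta>. \<gamma> = \<beta> @ Inr b # \<delta> \<longrightarrow> meets X (lefts \<beta>))"

lemma meets_append: "meets X \<alpha> \<Longrightarrow> meets X (\<alpha> @ \<beta>)"
  by (auto simp: meets_def)

lemma meets_empty [simp]: "meets {} \<alpha>"
  by (simp add: meets_def)

lemma guarded_Nil [simp]: "guarded X []"
  by (simp add: guarded_def)

lemma guarded_empty [simp]: "guarded {} \<gamma>"
  by (simp add: guarded_def)

lemma guarded_snoc_Inl [simp]: "guarded X (\<gamma> @ [Inl a]) \<longleftrightarrow> guarded X \<gamma>"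
proof -
  have "(\<gamma> @ [Inl a] = \<beta> @ Inr b # \<delta>) \<longleftrightarrow> (\<exists>\<delta>'. \<delta> = \<delta>' @ [Inl a] \<and> \<gamma> = \<beta> @ Inr b # \<delta>')" for \<beta> b \<delta>
    by (cases \<delta> rule: rev_cases) auto
  then show ?thesis
    unfolding guarded_def by blast
qed

lemma guarded_snoc_Inr [simp]:
  "guarded X (\<gamma> @ [Inr b]) \<longleftrightarrow> guarded X \<gamma> \<and> meets X (lefts \<gamma>)"
proof
  assume *: "guarded X (\<gamma> @ [Inr b])"
  then have "meets X (lefts \<gamma>)"
    unfolding guarded_def by blast
  moreover have "meets X (lefts \<beta>)" if "\<gamma> = \<beta> @ Inr c # \<delta>" for \<beta> c \<delta>
    using *[unfolded guarded_def, rule_format, of \<beta> c "\<delta> @ [Inr b]"] that by simp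
  ultimately show "guarded X \<gamma> \<and> meets X (lefts \<gamma>)"
    unfolding guarded_def by blast
next
  assume *: "guarded X \<gamma> \<and> meets X (lefts \<gamma>)"
  have "meets X (lefts \<beta>)" if "\<gamma> @ [Inr b] = \<beta> @ Inr c # \<delta>" for \<beta> c \<delta>
    using * that by (cases \<delta> rule: rev_cases) (auto simp: guarded_def)
  then show "guarded X (\<gamma> @ [Inr b])"
    unfolding guarded_def by blast
qed

lemma guarded_append_Inr:
  "guarded X \<gamma> \<Longrightarrow> meets X (lefts \<gamma>) \<Longrightarrow> guarded X (\<gamma> @ map Inr bs)"
proof (induction bs rule: rev_induct)
  case (snoc b bs)
  have "guarded X ((\<gamma> @ map Inr bs) @ [Inr b])"
    unfolding guarded_snoc_Inr using snoc by simp
  then show ?case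
    by simp
qed simp

text \<open>A guard that has been met stays met, so a single right event in the past certifies it
  for good.\<close>

lemma guarded_meets:
  assumes "guarded X \<gamma>" "rights \<gamma> \<noteq> []"
  shows "meets X (lefts \<gamma>)"
proof -
  obtain b where "Inr b \<in> set \<gamma>"
    using assms(2) set_rights[of \<gamma>] by (cases "rights \<gamma>") auto
  then obtain \<beta> \<delta> where "\<gamma> = \<beta> @ Inr b # \<delta>"
    by (meson split_list)
  then show ?thesis
    using assms(1) by (auto simp: guarded_def intro: meets_append)
qed

text \<open>Both \<open>\<A> \<cdot> \<B>\<close> and \<open>\<A> \<parallel> \<B>\<close> have as traces the interleavings of traces of \<open>\<A>\<close> and \<open>\<B>\<close> in which
  \<open>\<B>\<close> acts only after every set in \<open>X\<close> has been met, where \<open>X\<close> is \<open>\<Phi>\<^sub>\<A>\<close> and \<open>\<emptyset>\<close>, respectively.\<close>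

definition guarded_product ::
    "'a set set \<Rightarrow> ('a, 's::finite) ipbes \<Rightarrow> ('b, 's) ipbes \<Rightarrow> ('a + 'b, 's) ipbes \<Rightarrow> bool" where
  "guarded_product X \<A> \<B> \<C> \<longleftrightarrow> events \<C> = Inl ` events \<A> \<union> Inr ` events \<B> \<and>
     label \<C> = case_sum (label \<A>) (label \<B>) \<and>
     traces \<C> = {\<gamma>. lefts \<gamma> \<in> traces \<A> \<and> rights \<gamma> \<in> traces \<B> \<and> guarded X \<gamma>}"

text \<open>The guard bundles point only to initial events of \<B>, yet they delay all of \<B>:
  while no right event has occurred, an event with a bundle in \<B> is blocked anyway, so the first
  right event is initial and has to wait for \<open>X\<close>.\<close>

lemma guarded_productI:
  assumes ev: "events \<C> = Inl ` events \<A> \<union> Inr ` events \<B>"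
    and lab: "label \<C> = case_sum (label \<A>) (label \<B>)"
    and bl: "\<And>y a. (y, Inl a) \<in> bundles \<C> \<longleftrightarrow> (\<exists>x. y = Inl ` x \<and> (x, a) \<in> bundles \<A>)"
    and br: "\<And>y b. (y, Inr b) \<in> bundles \<C> \<longleftrightarrow>
      (\<exists>x. y = Inr ` x \<and> (x, b) \<in> bundles \<B>) \<or> (\<exists>x. y = Inl ` x \<and> x \<in> X \<and> b \<in> initial \<B>)"
    and cf: "conflict \<C> = copy_conflict Inl \<A> \<union> copy_conflict Inr \<B>"
  shows "guarded_product X \<A> \<B> \<C>"
proof -
  have "\<gamma> \<in> traces \<C> \<longleftrightarrow> lefts \<gamma> \<in> traces \<A> \<and> rights \<gamma> \<in> traces \<B> \<and> guarded X \<gamma>" for \<gamma>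
  proof (induction \<gamma> rule: rev_induct)
    case (snoc z \<gamma>)
    have L: "set \<gamma> \<inter> Inl ` x = {} \<longleftrightarrow> set (lefts \<gamma>) \<inter> x = {}" for x
      by auto
    have R: "set \<gamma> \<inter> Inr ` x = {} \<longleftrightarrow> set (rights \<gamma>) \<inter> x = {}" for x
      by auto
    show ?case
    proof (cases z)
      case (Inl a)
      have bundles: "(\<forall>y. (y, Inl a) \<in> bundles \<C> \<longrightarrow> set \<gamma> \<inter> y \<noteq> {}) \<longleftrightarrow>
          (\<forall>x. (x, a) \<in> bundles \<A> \<longrightarrow> set (lefts \<gamma>) \<inter> x \<noteq> {})"
        unfolding bl L[symmetric] by metis
      have conf: "(\<forall>c\<in>set \<gamma>. (Inl a, c) \<notin> conflict \<C> \<and> (c, Inl a) \<notin> conflict \<C>) \<longleftrightarrow>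
          (\<forall>c\<in>set (lefts \<gamma>). (a, c) \<notin> conflict \<A> \<and> (c, a) \<notin> conflict \<A>)"
        unfolding cf copy_conflict_def by auto
      have rest: "Inl a \<in> events \<C> \<longleftrightarrow> a \<in> events \<A>" "Inl a \<in> set \<gamma> \<longleftrightarrow> a \<in> set (lefts \<gamma>)"
        "(Inl a, Inl a) \<in> conflict \<C> \<longleftrightarrow> (a, a) \<in> conflict \<A>"
        unfolding ev cf copy_conflict_def by auto
      have proj: "lefts (\<gamma> @ [Inl a]) = lefts \<gamma> @ [a]" "rights (\<gamma> @ [Inl a]) = rights \<gamma>" for a
        by simp_all
      show ?thesis
        unfolding Inl proj guarded_snoc_Inl traces_snoc snoc bundles conf rest by blast
    next
      case (Inr b)
      have bundles: "(\<forall>y. (y, Inr b) \<in> bundles \<C> \<longrightarrow> set \<gamma> \<inter> y \<noteq> {}) \<longleftrightarrow>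
          (\<forall>x. (x, b) \<in> bundles \<B> \<longrightarrow> set (rights \<gamma>) \<inter> x \<noteq> {}) \<and>
          (b \<in> initial \<B> \<longrightarrow> meets X (lefts \<gamma>))"
        unfolding br meets_def L[symmetric] R[symmetric] by metis
      have guard: "meets X (lefts \<gamma>)"
        if "guarded X \<gamma>" "b \<in> events \<B>" "b \<in> initial \<B> \<longrightarrow> meets X (lefts \<gamma>)"
          "\<forall>x. (x, b) \<in> bundles \<B> \<longrightarrow> set (rights \<gamma>) \<inter> x \<noteq> {}"
      proof (cases "rights \<gamma> = []")
        case True
        then have "b \<in> initial \<B>"
          using that by (auto simp: initial_def simp del: set_rights)
        then show ?thesis
          using that by simp
      qed (use that guarded_meets in blast)
      have conf: "(\<forall>c\<in>set \<gamma>. (Inr b, c) \<notin> conflict \<C> \<and> (c, Inr b) \<notin> conflict \<C>) \<longleftrightarrow>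
          (\<forall>c\<in>set (rights \<gamma>). (b, c) \<notin> conflict \<B> \<and> (c, b) \<notin> conflict \<B>)"
        unfolding cf copy_conflict_def by auto
      have rest: "Inr b \<in> events \<C> \<longleftrightarrow> b \<in> events \<B>" "Inr b \<in> set \<gamma> \<longleftrightarrow> b \<in> set (rights \<gamma>)"
        "(Inr b, Inr b) \<in> conflict \<C> \<longleftrightarrow> (b, b) \<in> conflict \<B>"
        unfolding ev cf copy_conflict_def by auto
      have proj: "lefts (\<gamma> @ [Inr b]) = lefts \<gamma>" "rights (\<gamma> @ [Inr b]) = rights \<gamma> @ [b]" for b
        by simp_all
      show ?thesis
        unfolding Inr proj guarded_snoc_Inr traces_snoc snoc bundles conf rest using guard by blast
    qed
  qed simp
  then show ?thesis
    using ev lab by (auto simp: guarded_product_def)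
qed

lemma guarded_product_par: "guarded_product {} \<A> \<B> (\<A> \<parallel>\<^sub>p \<B>)"
  by (rule guarded_productI) (auto simp: par_comp_def copy_bundles_def)

lemma guarded_product_seq: "guarded_product (exits \<A>) \<A> \<B> (\<A> \<odot> \<B>)"
  by (rule guarded_productI) (auto simp: seq_comp_def copy_bundles_def)

lemma traces_par: "\<gamma> \<in> traces (\<A> \<parallel>\<^sub>p \<B>) \<longleftrightarrow> lefts \<gamma> \<in> traces \<A> \<and> rights \<gamma> \<in> traces \<B>"
  using guarded_product_par[of \<A> \<B>] by (simp add: guarded_product_def)

text \<open>Left events are never guarded. If the guard is not met, the right component has not
  started, and its empty projection says nothing about maximality in \<B>.\<close>

lemma guarded_product_maxD:
  assumes C: "guarded_product X \<A> \<B> \<C>" and "\<gamma> \<in> max_traces \<C>"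
  shows "lefts \<gamma> \<in> max_traces \<A>" "meets X (lefts \<gamma>) \<Longrightarrow> rights \<gamma> \<in> max_traces \<B>"
proof -
  have tr: "traces \<C> = {\<gamma>. lefts \<gamma> \<in> traces \<A> \<and> rights \<gamma> \<in> traces \<B> \<and> guarded X \<gamma>}"
    using C by (simp add: guarded_product_def)
  have "\<gamma> @ [Inl a] \<notin> traces \<C>" "\<gamma> @ [Inr b] \<notin> traces \<C>" for a b
    using assms(2) by (auto simp: max_traces_iff)
  moreover have "\<gamma> \<in> traces \<C>"
    using assms(2) by (rule max_traces_subset)
  ultimately show "lefts \<gamma> \<in> max_traces \<A>" "meets X (lefts \<gamma>) \<Longrightarrow> rights \<gamma> \<in> max_traces \<B>"
    unfolding tr by (auto simp: max_traces_iff)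
qed

lemma guarded_product_maxI:
  assumes C: "guarded_product X \<A> \<B> \<C>" and "\<gamma> \<in> traces \<C>" "lefts \<gamma> \<in> max_traces \<A>"
    "meets X (lefts \<gamma>) \<Longrightarrow> rights \<gamma> \<in> max_traces \<B>"
  shows "\<gamma> \<in> max_traces \<C>"
proof -
  have tr: "traces \<C> = {\<gamma>. lefts \<gamma> \<in> traces \<A> \<and> rights \<gamma> \<in> traces \<B> \<and> guarded X \<gamma>}"
    using C by (simp add: guarded_product_def)
  have "\<gamma> @ [z] \<notin> traces \<C>" for z
    using assms(3,4) unfolding tr by (cases z) (auto simp: max_traces_iff)
  then show ?thesis
    using assms(2) by (simp add: max_traces_iff)
qed

text \<open>If the left projection can be extended, feasibility of \<A> provides the event.
  Otherwise a trace that is not maximal must have met its guard and have a right projection that can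
  be extended.\<close>

lemma feasible_guarded_product:
  assumes C: "guarded_product X \<A> \<B> \<C>" and A: "feasible \<A>" and B: "feasible \<B>"
  shows "feasible \<C>"
  unfolding feasible_def
proof (intro ballI set_eqI iffI UNIV_I)
  fix \<gamma> s
  assume \<gamma>: "\<gamma> \<in> traces \<C> - max_traces \<C>"
  have tr: "traces \<C> = {\<gamma>. lefts \<gamma> \<in> traces \<A> \<and> rights \<gamma> \<in> traces \<B> \<and> guarded X \<gamma>}"
    and lab: "label \<C> = case_sum (label \<A>) (label \<B>)"
    using C by (simp_all add: guarded_product_def)
  show "s \<in> (\<Union>e\<in>enabled \<C> \<gamma>. {s. label \<C> e s \<noteq> {}})"
  proof (cases "lefts \<gamma> \<in> max_traces \<A>")
    case False
    then have "lefts \<gamma> \<in> traces \<A> - max_traces \<A>"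
      using \<gamma> tr by auto
    then have "s \<in> (\<Union>e\<in>enabled \<A> (lefts \<gamma>). {s. label \<A> e s \<noteq> {}})"
      using A unfolding feasible_def by blast
    then obtain a where "a \<in> enabled \<A> (lefts \<gamma>)" "label \<A> a s \<noteq> {}"
      by blast
    then show ?thesis
      using \<gamma> by (auto simp: enabled_def tr lab intro!: exI[of _ "Inl a"])
  next
    case True
    then have "meets X (lefts \<gamma>)" "rights \<gamma> \<notin> max_traces \<B>"
      using \<gamma> guarded_product_maxI[OF C, of \<gamma>] by auto
    then have "rights \<gamma> \<in> traces \<B> - max_traces \<B>"
      using \<gamma> tr by auto
    then have "s \<in> (\<Union>e\<in>enabled \<B> (rights \<gamma>). {s. label \<B> e s \<noteq> {}})"
      using B unfolding feasible_def by blast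
    then obtain b where "b \<in> enabled \<B> (rights \<gamma>)" "label \<B> b s \<noteq> {}"
      by blast
    then show ?thesis
      using \<gamma> \<open>meets X (lefts \<gamma>)\<close> by (auto simp: enabled_def tr lab intro!: exI[of _ "Inr b"])
  qed
qed

text \<open>Simulating the right component: an event of \<open>\<B>\<close> is replaced by the events, at most one, that
  \<open>g\<close> appends at this point.\<close>

primrec map_right_rev :: "('b list \<Rightarrow> 'c list) \<Rightarrow> ('a + 'b) list \<Rightarrow> ('a + 'c) list" where
  "map_right_rev g [] = []"
| "map_right_rev g (z # \<rho>) = map_right_rev g \<rho> @ (case z of Inl a \<Rightarrow> [Inl a]
     | Inr b \<Rightarrow> map Inr (drop (length (g (rights (rev \<rho>)))) (g (rights (rev \<rho>) @ [b]))))"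

definition map_right :: "('b list \<Rightarrow> 'c list) \<Rightarrow> ('a + 'b) list \<Rightarrow> ('a + 'c) list" where
  "map_right g \<gamma> = map_right_rev g (rev \<gamma>)"

lemma map_right_simps [simp]:
  "map_right g [] = []"
  "map_right g (\<gamma> @ [Inl a]) = map_right g \<gamma> @ [Inl a]"
  "map_right g (\<gamma> @ [Inr b]) = map_right g \<gamma> @
     map Inr (drop (length (g (rights \<gamma>))) (g (rights \<gamma> @ [b])))"
  by (simp_all add: map_right_def)

text \<open>Left events are copied, so the guard has the same truth value on both sides. If it is
  met, a completion of the right image is appended; if not, the target is blocked as well and the
  image is maximal. The right projection of a nonempty maximal trace may be empty, which is why
  completeness of the simulation is needed here.\<close>

lemma guarded_product_mono:
  assumes C: "guarded_product X \<A> \<B> \<C>" and C': "guarded_product X \<A> \<B>' \<C>'" and "\<B> \<sqsubseteq>\<^sub>c \<B>'"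
  shows "\<C> \<sqsubseteq>\<^sub>c \<C>'"
proof -
  obtain g where g: "complete_t_simulation \<B> \<B>' g"
    using assms(3) by (auto simp: complete_sim_def)
  note gD = complete_t_simulationD[OF g]
  have tr: "traces \<C> = {\<gamma>. lefts \<gamma> \<in> traces \<A> \<and> rights \<gamma> \<in> traces \<B> \<and> guarded X \<gamma>}"
    "traces \<C>' = {\<gamma>. lefts \<gamma> \<in> traces \<A> \<and> rights \<gamma> \<in> traces \<B>' \<and> guarded X \<gamma>}"
    and lab: "label \<C> = case_sum (label \<A>) (label \<B>)" "label \<C>' = case_sum (label \<A>) (label \<B>')"
    and ev: "events \<C>' = Inl ` events \<A> \<union> Inr ` events \<B>'"
    using C C' by (simp_all add: guarded_product_def)
  have h: "lefts (map_right g \<gamma>) = lefts \<gamma> \<and> rights (map_right g \<gamma>) = g (rights \<gamma>) \<and>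
      guarded X (map_right g \<gamma>)" if "\<gamma> \<in> traces \<C>" for \<gamma>
    using that
  proof (induction \<gamma> rule: rev_induct)
    case Nil
    then show ?case
      by (simp add: gD(2))
  next
    case (snoc z \<gamma>)
    from snoc.IH[OF traces_snocD(1)[OF snoc.prems]]
    have IH: "lefts (map_right g \<gamma>) = lefts \<gamma>" "rights (map_right g \<gamma>) = g (rights \<gamma>)"
      "guarded X (map_right g \<gamma>)"
      by simp_all
    show ?case
    proof (cases z)
      case (Inl a)
      then show ?thesis
        using IH by simp
    next
      case (Inr b)
      then have *: "rights \<gamma> @ [b] \<in> traces \<B>" "meets X (lefts \<gamma>)"
        using snoc.prems by (auto simp: tr)
      from gD(4)[OF *(1)] have "\<exists>es. g (rights \<gamma> @ [b]) = g (rights \<gamma>) @ es"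
        by auto
      then obtain es where "g (rights \<gamma> @ [b]) = g (rights \<gamma>) @ es" ..
      then show ?thesis
        using IH * Inr by (simp add: guarded_append_Inr)
    qed
  qed
  show ?thesis
  proof (rule complete_simI[where f = "map_right g"])
    show h_traces: "map_right g \<gamma> \<in> traces \<C>'" if "\<gamma> \<in> traces \<C>" for \<gamma>
      using that h[OF that] gD(1) by (simp add: tr)
    show "finite {\<gamma> \<in> traces \<C>. map_right g \<gamma> = \<beta>}" if "\<beta> \<in> traces \<C>'" for \<beta>
    \<comment> \<open>The trace \<beta> fixes the left projection, leaves finitely many right
      projections by the fibres of \<open>g\<close>, and each pair has finitely many
      interleavings.\<close>
    proof (rule finite_subset)
      show "{\<gamma> \<in> traces \<C>. map_right g \<gamma> = \<beta>} \<subseteq>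
          (\<Union>\<delta>\<in>{\<delta> \<in> traces \<B>. g \<delta> = rights \<beta>}. {\<gamma>. lefts \<gamma> = lefts \<beta> \<and> rights \<gamma> = \<delta>})"
        using h by (auto simp: tr)
      show "finite \<dots>"
        using gD(3)[of "rights \<beta>"] that by (auto simp: tr finite_interleavings)
    qed
    show "map_right g (\<gamma> @ [z]) = map_right g \<gamma> \<and> label \<C> z \<sqsubseteq>\<^sub>H skip \<or>
        (\<exists>z'\<in>events \<C>'. label \<C> z \<sqsubseteq>\<^sub>H label \<C>' z' \<and> map_right g (\<gamma> @ [z]) = map_right g \<gamma> @ [z'])"
      if \<gamma>: "\<gamma> @ [z] \<in> traces \<C>" for \<gamma> z
    proof (cases z)
      case (Inl a)
      then have "a \<in> events \<A>"
        using \<gamma> by (auto simp: tr dest: traces_snocD)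
      then show ?thesis
        using Inl by (auto simp: lab ev)
    next
      case (Inr b)
      then have "rights \<gamma> @ [b] \<in> traces \<B>"
        using \<gamma> by (auto simp: tr)
      from gD(4)[OF this] show ?thesis
        using Inr by (auto simp: lab ev)
    qed
    show "\<exists>z'\<in>events \<C>'. label \<C> z \<sqsubseteq>\<^sub>H label \<C>' z' \<and> map_right g (\<gamma> @ [z]) = map_right g \<gamma> @ [z']"
      if \<gamma>: "\<gamma> @ [z] \<in> max_traces \<C>" for \<gamma> z
    proof (cases z)
      case (Inl a)
      then have "a \<in> events \<A>"
        using max_traces_subset[OF \<gamma>] by (auto simp: tr dest: traces_snocD)
      then show ?thesis
        using Inl by (auto simp: lab ev)
    next
      case (Inr b)
      then have "meets X (lefts (\<gamma> @ [z]))"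
        using max_traces_subset[OF \<gamma>] by (auto simp: tr)
      from guarded_product_maxD(2)[OF C \<gamma> this] have "rights \<gamma> @ [b] \<in> max_traces \<B>"
        using Inr by simp
      from gD(5)[OF this] show ?thesis
        using Inr by (auto simp: lab ev)
    qed
    show "weakly_maximal \<C>' (map_right g \<gamma>)" if \<gamma>: "\<gamma> \<in> max_traces \<C>" for \<gamma>
    proof -
      have \<gamma>_tr: "\<gamma> \<in> traces \<C>"
        using \<gamma> by (rule max_traces_subset)
      note h\<gamma> = h[OF this] and h_tr = h_traces[OF \<gamma>_tr]
      show ?thesis
      proof (cases "meets X (lefts \<gamma>)")
        case True
        then obtain es where es: "g (rights \<gamma>) @ es \<in> max_traces \<B>'"
          "\<forall>e\<in>set es. skip \<sqsubseteq>\<^sub>H label \<B>' e"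
          using gD(6)[OF guarded_product_maxD(2)[OF C \<gamma>]] by (auto simp: weakly_maximal_def)
        have "map_right g \<gamma> @ map Inr es \<in> max_traces \<C>'"
        proof (rule guarded_product_maxI[OF C'])
          show "map_right g \<gamma> @ map Inr es \<in> traces \<C>'"
            using h\<gamma> \<gamma>_tr True es(1) by (auto simp: tr guarded_append_Inr dest: max_traces_subset)
          show "lefts (map_right g \<gamma> @ map Inr es) \<in> max_traces \<A>"
            using h\<gamma> guarded_product_maxD(1)[OF C \<gamma>] by simp
          show "rights (map_right g \<gamma> @ map Inr es) \<in> max_traces \<B>'"
            using h\<gamma> es by simp
        qed
        then show ?thesis
          using es(2) h_tr unfolding weakly_maximal_def by (auto simp: lab intro!: exI[of _ "map Inr es"])
      next
        case False
        then show ?thesis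
          using h\<gamma> h_tr guarded_product_maxD(1)[OF C \<gamma>]
          by (intro max_weakly_maximal guarded_product_maxI[OF C']) auto
      qed
    qed
  qed simp
qed

lemma par_mono_right: "\<B> \<sqsubseteq>\<^sub>c \<B>' \<Longrightarrow> \<A> \<parallel>\<^sub>p \<B> \<sqsubseteq>\<^sub>c \<A> \<parallel>\<^sub>p \<B>'"
  by (rule guarded_product_mono[OF guarded_product_par guarded_product_par])

lemma seq_mono_right: "\<B> \<sqsubseteq>\<^sub>c \<B>' \<Longrightarrow> \<A> \<odot> \<B> \<sqsubseteq>\<^sub>c \<A> \<odot> \<B>'"
  by (rule guarded_product_mono[OF guarded_product_seq guarded_product_seq])

lemma Nil_max_par: "[] \<in> max_traces (\<A> \<parallel>\<^sub>p \<B>) \<Longrightarrow> [] \<in> max_traces \<A>"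
  "[] \<in> max_traces (\<A> \<parallel>\<^sub>p \<B>) \<Longrightarrow> [] \<in> max_traces \<B>"
  using guarded_product_maxD[OF guarded_product_par, of "[]" \<A> \<B>] by auto


section \<open>Renamings of events\<close>

text \<open>Every event of \<F> is an image, so a possible extension of an image trace pulls back to
  \<E> and maximality is preserved; injectivity makes the fibres finite.\<close>

lemma complete_sim_rename:
  assumes "inj h" and ev: "events \<F> = h ` events \<E>" and lab: "\<And>e. label \<F> (h e) = label \<E> e"
    and tr: "\<And>\<alpha>. map h \<alpha> \<in> traces \<F> \<longleftrightarrow> \<alpha> \<in> traces \<E>"
  shows "\<E> \<sqsubseteq>\<^sub>c \<F>"
proof (rule complete_simI[where f = "map h"])
  have "\<exists>e'\<in>events \<F>. label \<E> e \<sqsubseteq>\<^sub>H label \<F> e' \<and> map h (\<alpha> @ [e]) = map h \<alpha> @ [e']"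
    if "\<alpha> @ [e] \<in> traces \<E>" for \<alpha> e
    using traces_snocD(2)[OF that] by (intro bexI[of _ "h e"]) (simp_all add: ev lab)
  then show "map h (\<alpha> @ [e]) = map h \<alpha> \<and> label \<E> e \<sqsubseteq>\<^sub>H skip \<or>
      (\<exists>e'\<in>events \<F>. label \<E> e \<sqsubseteq>\<^sub>H label \<F> e' \<and> map h (\<alpha> @ [e]) = map h \<alpha> @ [e'])"
    if "\<alpha> @ [e] \<in> traces \<E>" for \<alpha> e
    using that by blast
  show "\<exists>e'\<in>events \<F>. label \<E> e \<sqsubseteq>\<^sub>H label \<F> e' \<and> map h (\<alpha> @ [e]) = map h \<alpha> @ [e']"
    if "\<alpha> @ [e] \<in> max_traces \<E>" for \<alpha> e
    using traces_snocD(2)[OF max_traces_subset[OF that]] by (intro bexI[of _ "h e"]) (simp_all add: ev lab)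
  show "finite {\<alpha> \<in> traces \<E>. map h \<alpha> = \<beta>}" for \<beta>
    using finite_vimageI[of "{\<beta>}" "map h"] \<open>inj h\<close> by (simp add: vimage_def)
  show "weakly_maximal \<F> (map h \<alpha>)" if \<alpha>: "\<alpha> \<in> max_traces \<E>" for \<alpha>
  proof -
    have "map h \<alpha> @ [e] \<notin> traces \<F>" for e
    proof
      assume e: "map h \<alpha> @ [e] \<in> traces \<F>"
      then obtain a where "e = h a"
        using traces_snocD(2)[OF e] ev by blast
      then show False
        using e \<alpha> tr[of "\<alpha> @ [a]"] by (auto simp: max_traces_iff)
    qed
    then have "map h \<alpha> \<in> max_traces \<F>"
      using max_traces_subset[OF \<alpha>] unfolding max_traces_iff tr by blast
    then show ?thesis
      by (rule max_weakly_maximal)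
  qed
qed (simp_all add: tr)

lemma par_comm: "\<A> \<parallel>\<^sub>p \<B> \<sqsubseteq>\<^sub>c \<B> \<parallel>\<^sub>p \<A>"
proof (rule complete_sim_rename[where h = "case_sum Inr Inl"])
  show "inj (case_sum Inr Inl)"
    by (auto simp: inj_def split: sum.split)
  have "lefts (map (case_sum Inr Inl) \<alpha>) = rights \<alpha>" "rights (map (case_sum Inr Inl) \<alpha>) = lefts \<alpha>"
    for \<alpha> :: "('a + 'b) list"
    by (induction \<alpha>) (auto split: sum.split)
  then show "map (case_sum Inr Inl) \<alpha> \<in> traces (\<B> \<parallel>\<^sub>p \<A>) \<longleftrightarrow> \<alpha> \<in> traces (\<A> \<parallel>\<^sub>p \<B>)" for \<alpha>
    by (auto simp: traces_par)
qed (auto simp: par_comp_def image_Un image_image split: sum.split)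

lemma par_assoc: "(\<A> \<parallel>\<^sub>p \<B>) \<parallel>\<^sub>p \<C> \<sqsubseteq>\<^sub>c \<A> \<parallel>\<^sub>p (\<B> \<parallel>\<^sub>p \<C>)"
proof (rule complete_sim_rename[where h = "case_sum (case_sum Inl (Inr \<circ> Inl)) (Inr \<circ> Inr)"])
  let ?h = "case_sum (case_sum Inl (Inr \<circ> Inl)) (Inr \<circ> Inr) :: ('a + 'b) + 'c \<Rightarrow> 'a + ('b + 'c)"
  show "inj ?h"
    by (auto simp: inj_def split: sum.split)
  have "lefts (map ?h \<alpha>) = lefts (lefts \<alpha>)" "lefts (rights (map ?h \<alpha>)) = rights (lefts \<alpha>)"
    "rights (rights (map ?h \<alpha>)) = rights \<alpha>" for \<alpha>
    by (induction \<alpha>) (auto split: sum.split)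
  then show "map ?h \<alpha> \<in> traces (\<A> \<parallel>\<^sub>p (\<B> \<parallel>\<^sub>p \<C>)) \<longleftrightarrow> \<alpha> \<in> traces ((\<A> \<parallel>\<^sub>p \<B>) \<parallel>\<^sub>p \<C>)" for \<alpha>
    by (auto simp: traces_par)
qed (auto simp: par_comp_def image_Un image_image Un_assoc split: sum.split)

text \<open>The only trace of \<A> is the empty one, so traces of the product consist of right
  events alone.\<close>

lemma par_inert_left:
  assumes "[] \<in> max_traces \<A>"
  shows "\<A> \<parallel>\<^sub>p \<B> \<sqsubseteq>\<^sub>c \<B>"
proof -
  have inert: "lefts \<gamma> = []" if "\<gamma> \<in> traces (\<A> \<parallel>\<^sub>p \<B>)" for \<gamma>
    using max_traces_prefixD[OF assms, of "lefts \<gamma>"] that by (simp add: traces_par)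
  have step: "\<exists>b. z = Inr b \<and> b \<in> events \<B>" if "\<gamma> @ [z] \<in> traces (\<A> \<parallel>\<^sub>p \<B>)" for \<gamma> z
    using inert[OF that] that by (cases z) (auto simp: traces_par dest: traces_snocD)
  show ?thesis
  proof (rule complete_simI[where f = rights])
    show "finite {\<gamma> \<in> traces (\<A> \<parallel>\<^sub>p \<B>). rights \<gamma> = \<beta>}" for \<beta>
      by (rule finite_subset[OF _ finite_interleavings[of "[]" \<beta>]]) (use inert in auto)
    have lab: "label (\<A> \<parallel>\<^sub>p \<B>) (Inr b) = label \<B> b" for b
      by (simp add: par_comp_def)
    show "rights (\<gamma> @ [z]) = rights \<gamma> \<and> label (\<A> \<parallel>\<^sub>p \<B>) z \<sqsubseteq>\<^sub>H skip \<or>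
        (\<exists>b\<in>events \<B>. label (\<A> \<parallel>\<^sub>p \<B>) z \<sqsubseteq>\<^sub>H label \<B> b \<and> rights (\<gamma> @ [z]) = rights \<gamma> @ [b])"
      if "\<gamma> @ [z] \<in> traces (\<A> \<parallel>\<^sub>p \<B>)" for \<gamma> z
      using step[OF that] lab by auto
    show "\<exists>b\<in>events \<B>. label (\<A> \<parallel>\<^sub>p \<B>) z \<sqsubseteq>\<^sub>H label \<B> b \<and> rights (\<gamma> @ [z]) = rights \<gamma> @ [b]"
      if "\<gamma> @ [z] \<in> max_traces (\<A> \<parallel>\<^sub>p \<B>)" for \<gamma> z
      using step[OF max_traces_subset[OF that]] lab by auto
    show "weakly_maximal \<B> (rights \<gamma>)" if "\<gamma> \<in> max_traces (\<A> \<parallel>\<^sub>p \<B>)" for \<gamma>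
      using guarded_product_maxD(2)[OF guarded_product_par that] by (simp add: max_weakly_maximal)
  qed (auto simp: traces_par)
qed

text \<open>Monotonicity is available directly only in the right factor, hence the detour through
  commutativity.\<close>

lemma par_mono:
  assumes "\<A> \<sqsubseteq>\<^sub>c \<A>'" "\<B> \<sqsubseteq>\<^sub>c \<B>'"
  shows "\<A> \<parallel>\<^sub>p \<B> \<sqsubseteq>\<^sub>c \<A>' \<parallel>\<^sub>p \<B>'"
proof -
  have "\<A> \<parallel>\<^sub>p \<B> \<sqsubseteq>\<^sub>c \<B>' \<parallel>\<^sub>p \<A>"
    by (rule complete_sim_trans[OF par_mono_right[OF assms(2)] par_comm])
  then have "\<A> \<parallel>\<^sub>p \<B> \<sqsubseteq>\<^sub>c \<B>' \<parallel>\<^sub>p \<A>'"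
    by (rule complete_sim_trans[OF _ par_mono_right[OF assms(1)]])
  then show ?thesis
    by (rule complete_sim_trans[OF _ par_comm])
qed


section \<open>Cones over sets of distributions\<close>

definition mass :: "real^'s::finite \<Rightarrow> real" where
  "mass v = (\<Sum>u\<in>UNIV. v $ u)"

lemma mass_0 [simp]: "mass 0 = 0"
  by (simp add: mass_def)

lemma mass_add: "mass (v + w) = mass v + mass w"
  by (simp add: mass_def sum.distrib)

lemma mass_scaleR [simp]: "mass (c *\<^sub>R v) = c * mass v"
  by (simp add: mass_def sum_distrib_left)

lemma mass_sum: "mass (\<Sum>x\<in>A. f x) = (\<Sum>x\<in>A. mass (f x))"
  unfolding mass_def sum_component by (rule sum.swap)

lemma mass_distribution: "\<mu> \<in> distributions \<Longrightarrow> mass \<mu> = 1"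
  by (simp add: mass_def distributions_def)

lemma point_component: "point s $ u = (if u = s then 1 else 0)"
  by (simp add: point_def axis_def)

lemma mass_point [simp]: "mass (point s) = 1"
  by (simp add: mass_def point_component)

lemma sum_point: "(\<Sum>s\<in>UNIV. (v $ s) *\<^sub>R point s) = v"
  by (simp add: vec_eq_iff point_component if_distrib cong: if_cong)

lemma mass_nonneg: "(\<And>u. 0 \<le> v $ u) \<Longrightarrow> 0 \<le> mass v"
  by (simp add: mass_def sum_nonneg)

text \<open>Zero belongs to the cone even if \<open>S\<close> is empty. This matches schedulers,
  which give weight 0 to an event whose label is empty at the current state.\<close>

definition cone_over :: "(real^'s::finite) set \<Rightarrow> (real^'s) set" where
  "cone_over S = {v. v = 0 \<or> (\<exists>w>0. \<exists>\<mu>\<in>S. v = w *\<^sub>R \<mu>)}"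

lemma zero_in_cone_over [simp]: "0 \<in> cone_over S"
  by (simp add: cone_over_def)

lemma cone_over_mono: "S \<subseteq> S' \<Longrightarrow> cone_over S \<subseteq> cone_over S'"
  unfolding cone_over_def by blast

lemma scaleR_in_cone_over: "\<mu> \<in> S \<Longrightarrow> 0 \<le> w \<Longrightarrow> w *\<^sub>R \<mu> \<in> cone_over S"
  unfolding cone_over_def by (cases "w = 0") (auto simp: less_le)

lemma cone_over_scaleR:
  assumes "v \<in> cone_over S" "0 \<le> c"
  shows "c *\<^sub>R v \<in> cone_over S"
proof (cases "v = 0")
  case False
  then obtain w \<mu> where "w > 0" "\<mu> \<in> S" "v = w *\<^sub>R \<mu>"
    using assms(1) by (auto simp: cone_over_def)
  then show ?thesis
    using assms(2) scaleR_in_cone_over[of \<mu> S "c * w"] by simp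
qed simp

text \<open>After division by the total weight the sum is a convex combination. This allows several
  events of a simulated structure to be merged into one.\<close>

lemma cone_over_add:
  assumes "convex S" "v \<in> cone_over S" "v' \<in> cone_over S"
  shows "v + v' \<in> cone_over S"
proof (cases "v = 0 \<or> v' = 0")
  case False
  then obtain w \<mu> w' \<mu>' where *: "w > 0" "\<mu> \<in> S" "v = w *\<^sub>R \<mu>" "w' > 0" "\<mu>' \<in> S" "v' = w' *\<^sub>R \<mu>'"
    using assms(2,3) by (auto simp: cone_over_def)
  have "(w / (w + w')) *\<^sub>R \<mu> + (w' / (w + w')) *\<^sub>R \<mu>' \<in> S"
    using * assms(1) by (intro convexD) (auto simp: divide_simps)
  moreover have "v + v' = (w + w') *\<^sub>R ((w / (w + w')) *\<^sub>R \<mu> + (w' / (w + w')) *\<^sub>R \<mu>')"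
    using * by (simp add: scaleR_add_right)
  ultimately show ?thesis
    using * scaleR_in_cone_over[of _ S "w + w'"] by simp
qed (use assms in auto)

lemma cone_over_sum:
  assumes "convex S" "\<And>x. x \<in> A \<Longrightarrow> f x \<in> cone_over S"
  shows "(\<Sum>x\<in>A. f x) \<in> cone_over S"
  using assms(2) by (induction A rule: infinite_finite_induct) (auto intro: cone_over_add[OF assms(1)])

lemma cone_over_nonneg:
  assumes "v \<in> cone_over S" "S \<subseteq> distributions"
  shows "0 \<le> v $ u"
  using assms by (auto simp: cone_over_def distributions_def subset_iff)

lemma cone_over_cases:
  assumes "v \<in> cone_over S" "S \<subseteq> distributions"
  obtains "v = 0" "mass v = 0" | \<mu> where "\<mu> \<in> S" "v = mass v *\<^sub>R \<mu>" "mass v > 0"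
proof (cases "v = 0")
  case False
  then obtain w \<mu> where v: "w > 0" "\<mu> \<in> S" "v = w *\<^sub>R \<mu>"
    using assms(1) by (auto simp: cone_over_def)
  then have "mass \<mu> = 1"
    using assms(2) mass_distribution by blast
  with v show thesis
    by (intro that(2)[of \<mu>]) simp_all
qed (use that(1) in simp)

lemma cone_over_mass_eq_0: "v \<in> cone_over S \<Longrightarrow> S \<subseteq> distributions \<Longrightarrow> mass v = 0 \<Longrightarrow> v = 0"
  by (erule cone_over_cases) auto

text \<open>Isolates what flows use about labels. It passes to products by inspecting events and
  labels only.\<close>

definition distribution_labelled :: "('e, 's::finite) ipbes \<Rightarrow> bool" where
  "distribution_labelled \<E> \<longleftrightarrow>
     (\<forall>e\<in>events \<E>. \<forall>t. label \<E> e t \<subseteq> distributions \<and> convex (label \<E> e t))"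

lemma point_in_distributions: "point s \<in> distributions"
  using mass_point[of s] by (simp add: distributions_def mass_def point_component)

lemma is_ipbes_distribution_labelled:
  assumes "is_ipbes \<E>"
  shows "distribution_labelled \<E>"
  unfolding distribution_labelled_def
proof (intro ballI allI)
  fix e t
  assume "e \<in> events \<E>"
  then have "label \<E> e \<in> programs \<union> tests"
    using assms by (auto simp: is_ipbes_def)
  then show "label \<E> e t \<subseteq> distributions \<and> convex (label \<E> e t)"
  proof
    assume "label \<E> e \<in> tests"
    then have "label \<E> e t = {} \<or> label \<E> e t = {point t}"
      unfolding tests_def by blast
    then show ?thesis
      using point_in_distributions by auto
  qed (simp add: programs_def)
qed

lemma enabled_traces: "e \<in> enabled \<E> \<alpha> \<longleftrightarrow> \<alpha> @ [e] \<in> traces \<E>"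
  by (simp add: enabled_def)

lemma distribution_labelledD:
  assumes "distribution_labelled \<E>" "e \<in> enabled \<E> \<alpha>"
  shows "label \<E> e t \<subseteq> distributions" "convex (label \<E> e t)"
  using assms traces_snocD(2)[of \<alpha> e \<E>] by (auto simp: distribution_labelled_def enabled_traces)


section \<open>Schedulers as flows\<close>

text \<open>A flow records the mass \<open>\<psi> \<alpha>\<close> reaching each trace and the part \<open>K \<alpha> e t\<close> of it that leaves
  from state \<open>t\<close> through the event \<open>e\<close>.  Unlike schedulers, flows can be added up.\<close>

definition is_flow ::
    "('e, 's::finite) ipbes \<Rightarrow> ('e list \<Rightarrow> real^'s) \<Rightarrow> ('e list \<Rightarrow> 'e \<Rightarrow> 's \<Rightarrow> real^'s) \<Rightarrow> bool" where
  "is_flow \<E> \<psi> K \<longleftrightarrow> (\<forall>\<alpha>\<in>traces \<E>. (\<forall>t. 0 \<le> \<psi> \<alpha> $ t) \<and>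
     (\<forall>e\<in>enabled \<E> \<alpha>. \<psi> (\<alpha> @ [e]) = (\<Sum>t\<in>UNIV. K \<alpha> e t) \<and> (\<forall>t. K \<alpha> e t \<in> cone_over (label \<E> e t))) \<and>
     (enabled \<E> \<alpha> \<noteq> {} \<longrightarrow> (\<forall>t. ((\<lambda>e. mass (K \<alpha> e t)) has_sum \<psi> \<alpha> $ t) (enabled \<E> \<alpha>))))"

lemma is_flowD:
  assumes "is_flow \<E> \<psi> K" "\<alpha> \<in> traces \<E>"
  shows "0 \<le> \<psi> \<alpha> $ t"
    and "e \<in> enabled \<E> \<alpha> \<Longrightarrow> \<psi> (\<alpha> @ [e]) = (\<Sum>t\<in>UNIV. K \<alpha> e t)"
    and "e \<in> enabled \<E> \<alpha> \<Longrightarrow> K \<alpha> e t \<in> cone_over (label \<E> e t)"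
    and "enabled \<E> \<alpha> \<noteq> {} \<Longrightarrow> ((\<lambda>e. mass (K \<alpha> e t)) has_sum \<psi> \<alpha> $ t) (enabled \<E> \<alpha>)"
  using assms unfolding is_flow_def by blast+

text \<open>Members of a label have mass 1, so the weight of an event is the mass of the scheduler's
  value. The existentially quantified weight function thereby disappears.\<close>

lemma scheduler_step:
  assumes \<sigma>: "is_scheduler \<E> \<sigma>" and lab: "distribution_labelled \<E>" and \<alpha>: "\<alpha> \<in> traces \<E>"
  shows "e \<in> enabled \<E> \<alpha> \<Longrightarrow> the (\<sigma> \<alpha> (e, t)) \<in> cone_over (label \<E> e t)"
    and "enabled \<E> \<alpha> \<noteq> {} \<Longrightarrow> ((\<lambda>e. mass (the (\<sigma> \<alpha> (e, t)))) has_sum 1) (enabled \<E> \<alpha>)"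
proof -
  obtain w where w: "\<And>e s. e \<in> events \<E> \<Longrightarrow> 0 \<le> w (e, s)"
    "\<And>e s. e \<in> enabled \<E> \<alpha> \<Longrightarrow> label \<E> e s \<noteq> {} \<Longrightarrow> \<exists>\<mu>\<in>label \<E> e s. \<sigma> \<alpha> (e, s) = Some (w (e, s) *\<^sub>R \<mu>)"
    "\<And>e s. e \<in> enabled \<E> \<alpha> \<Longrightarrow> label \<E> e s = {} \<Longrightarrow> w (e, s) = 0 \<and> \<sigma> \<alpha> (e, s) = Some 0"
    "\<And>s. enabled \<E> \<alpha> \<noteq> {} \<Longrightarrow> ((\<lambda>e. w (e, s)) has_sum 1) (enabled \<E> \<alpha>)"
    using \<sigma> \<alpha> unfolding is_scheduler_def by metis
  have *: "the (\<sigma> \<alpha> (e, t)) \<in> cone_over (label \<E> e t) \<and> mass (the (\<sigma> \<alpha> (e, t))) = w (e, t)"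
    if e: "e \<in> enabled \<E> \<alpha>" for e t
  proof (cases "label \<E> e t = {}")
    case False
    then obtain \<mu> where \<mu>: "\<mu> \<in> label \<E> e t" "\<sigma> \<alpha> (e, t) = Some (w (e, t) *\<^sub>R \<mu>)"
      using w(2)[OF e] by blast
    then have "mass \<mu> = 1"
      using distribution_labelledD(1)[OF lab e] by (intro mass_distribution) blast
    moreover have "0 \<le> w (e, t)"
      using e w(1) by (simp add: enabled_traces traces_snoc)
    ultimately show ?thesis
      using \<mu> by (simp add: scaleR_in_cone_over)
  qed (use w(3)[OF e] in simp)
  then show "e \<in> enabled \<E> \<alpha> \<Longrightarrow> the (\<sigma> \<alpha> (e, t)) \<in> cone_over (label \<E> e t)"
    by blast
  have "((\<lambda>e. mass (the (\<sigma> \<alpha> (e, t)))) has_sum 1) (enabled \<E> \<alpha>) \<longleftrightarrow>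
      ((\<lambda>e. w (e, t)) has_sum 1) (enabled \<E> \<alpha>)"
    by (rule has_sum_cong) (use * in blast)
  then show "enabled \<E> \<alpha> \<noteq> {} \<Longrightarrow> ((\<lambda>e. mass (the (\<sigma> \<alpha> (e, t)))) has_sum 1) (enabled \<E> \<alpha>)"
    using w(4) by blast
qed

lemma phi_append_singleton:
  "phi \<sigma> s (\<alpha> @ [e]) = (\<Sum>t\<in>UNIV. phi \<sigma> s \<alpha> $ t *\<^sub>R the (\<sigma> \<alpha> (e, t)))"
  by (simp add: vec_eq_iff phi_snoc mult.commute)

lemma phi_nonneg:
  assumes \<sigma>: "is_scheduler \<E> \<sigma>" and lab: "distribution_labelled \<E>" and "\<alpha> \<in> traces \<E>"
  shows "0 \<le> phi \<sigma> s \<alpha> $ u"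
  using assms(3)
proof (induction \<alpha> arbitrary: u rule: rev_induct)
  case Nil
  then show ?case
    by (simp add: phi_Nil point_component)
next
  case (snoc e \<alpha>)
  then have \<alpha>: "\<alpha> \<in> traces \<E>" and e: "e \<in> enabled \<E> \<alpha>"
    using traces_snocD(1) by (auto simp: enabled_traces)
  have "0 \<le> the (\<sigma> \<alpha> (e, t)) $ u" for t
    using scheduler_step(1)[OF \<sigma> lab \<alpha> e] distribution_labelledD(1)[OF lab e] by (rule cone_over_nonneg)
  then show ?case
    unfolding phi_snoc using snoc.IH[OF \<alpha>] by (intro sum_nonneg mult_nonneg_nonneg) auto
qed

text \<open>The scheduler does not depend on the initial state, so \<open>phi\<close> satisfies one
  linear recursion for all initial states and nonnegative mixtures satisfy it too.\<close>

lemma flow_of_scheduler: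
  assumes \<sigma>: "is_scheduler \<E> \<sigma>" and lab: "distribution_labelled \<E>" and \<nu>: "\<And>s. 0 \<le> \<nu> s"
  defines "\<psi> \<equiv> \<lambda>\<alpha>. \<Sum>s\<in>UNIV. \<nu> s *\<^sub>R phi \<sigma> s \<alpha>"
  shows "is_flow \<E> \<psi> (\<lambda>\<alpha> e t. \<psi> \<alpha> $ t *\<^sub>R the (\<sigma> \<alpha> (e, t)))"
  unfolding is_flow_def
proof (intro ballI conjI allI impI)
  fix \<alpha> t
  assume \<alpha>: "\<alpha> \<in> traces \<E>"
  show nn: "0 \<le> \<psi> \<alpha> $ t" for t
    unfolding \<psi>_def using \<nu> phi_nonneg[OF \<sigma> lab \<alpha>] by (auto intro!: sum_nonneg)
  show "\<psi> (\<alpha> @ [e]) = (\<Sum>t\<in>UNIV. \<psi> \<alpha> $ t *\<^sub>R the (\<sigma> \<alpha> (e, t)))" for e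
  proof -
    have "\<psi> (\<alpha> @ [e]) = (\<Sum>s\<in>UNIV. \<Sum>t\<in>UNIV. (\<nu> s * phi \<sigma> s \<alpha> $ t) *\<^sub>R the (\<sigma> \<alpha> (e, t)))"
      by (simp add: \<psi>_def phi_append_singleton scaleR_sum_right)
    also have "\<dots> = (\<Sum>t\<in>UNIV. \<Sum>s\<in>UNIV. (\<nu> s * phi \<sigma> s \<alpha> $ t) *\<^sub>R the (\<sigma> \<alpha> (e, t)))"
      by (rule sum.swap)
    finally show ?thesis
      by (simp add: \<psi>_def scaleR_sum_left)
  qed
  show "\<psi> \<alpha> $ t *\<^sub>R the (\<sigma> \<alpha> (e, t)) \<in> cone_over (label \<E> e t)" if "e \<in> enabled \<E> \<alpha>" for e t
    using scheduler_step(1)[OF \<sigma> lab \<alpha> that] nn by (rule cone_over_scaleR)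
  show "((\<lambda>e. mass (\<psi> \<alpha> $ t *\<^sub>R the (\<sigma> \<alpha> (e, t)))) has_sum \<psi> \<alpha> $ t) (enabled \<E> \<alpha>)"
    if "enabled \<E> \<alpha> \<noteq> {}"
    using has_sum_cmult_right[OF scheduler_step(2)[OF \<sigma> lab \<alpha> that, of t], of "\<psi> \<alpha> $ t"] by simp
qed

text \<open>Distinct maximal traces branch off somewhere: grouped by their first event after
  \<gamma>, their masses are bounded by induction by the masses of the one-event extensions, which
  together do not exceed the mass at \<gamma>. The number \<open>k\<close> bounds the remaining
  length. The purpose is a bound on the mass of outcomes before termination is known.\<close>

lemma flow_antichain_mass:
  assumes \<psi>: "is_flow \<E> \<psi> K" and lab: "distribution_labelled \<E>"
    and "finite X" "X \<subseteq> max_traces \<E>" "\<gamma> \<in> traces \<E>"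
    "\<And>\<beta>. \<beta> \<in> X \<Longrightarrow> prefix \<gamma> \<beta> \<and> length \<beta> \<le> length \<gamma> + k"
  shows "(\<Sum>\<beta>\<in>X. mass (\<psi> \<beta>)) \<le> mass (\<psi> \<gamma>)"
  using assms(3-)
proof (induction k arbitrary: X \<gamma>)
  case 0
  have "\<beta> = \<gamma>" if "\<beta> \<in> X" for \<beta>
    using 0(4)[OF that] by (auto simp: prefix_def)
  then have "X = {} \<or> X = {\<gamma>}"
    by blast
  then show ?case
    using mass_nonneg[OF is_flowD(1)[OF \<psi> \<open>\<gamma> \<in> traces \<E>\<close>]] by auto
next
  case (Suc k)
  show ?case
  proof (cases "\<gamma> \<in> max_traces \<E>")
    case True
    then have "X \<subseteq> {\<gamma>}"
      using Suc.prems max_traces_prefixD max_traces_subset by blast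
    then have "X = {} \<or> X = {\<gamma>}"
      by blast
    then show ?thesis
      using mass_nonneg[OF is_flowD(1)[OF \<psi> \<open>\<gamma> \<in> traces \<E>\<close>]] by auto
  next
    case False
    \<comment> \<open>The event of \<beta> right after \<gamma>. It exists because \<beta> is
      maximal and \<gamma> is not.\<close>
    let ?n = "\<lambda>\<beta>. \<beta> ! length \<gamma>"
    have ext: "prefix (\<gamma> @ [?n \<beta>]) \<beta> \<and> ?n \<beta> \<in> enabled \<E> \<gamma>" if "\<beta> \<in> X" for \<beta>
    proof -
      have "\<beta> \<in> max_traces \<E>" "prefix \<gamma> \<beta>" "\<beta> \<noteq> \<gamma>"
        using Suc.prems that False by auto
      then have p: "prefix (\<gamma> @ [?n \<beta>]) \<beta>"
        by (intro append_one_prefix) (auto simp: prefix_def)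
      then obtain \<delta> where "\<beta> = (\<gamma> @ [?n \<beta>]) @ \<delta>"
        by (auto simp: prefix_def)
      then have "(\<gamma> @ [?n \<beta>]) @ \<delta> \<in> traces \<E>"
        using max_traces_subset[OF \<open>\<beta> \<in> max_traces \<E>\<close>] by simp
      from traces_appendD[OF this] p show ?thesis
        by (simp add: enabled_traces)
    qed
    let ?N = "?n ` X"
    have N: "finite ?N" "?N \<subseteq> enabled \<E> \<gamma>"
      using Suc.prems ext by auto
    have step: "(\<Sum>\<beta>\<in>{\<beta>\<in>X. ?n \<beta> = e}. mass (\<psi> \<beta>)) \<le> mass (\<psi> (\<gamma> @ [e]))" if "e \<in> ?N" for e
    proof (rule Suc.IH)
      show "\<gamma> @ [e] \<in> traces \<E>"
        using that N by (auto simp: enabled_traces)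
      show "prefix (\<gamma> @ [e]) \<beta> \<and> length \<beta> \<le> length (\<gamma> @ [e]) + k" if "\<beta> \<in> {\<beta>\<in>X. ?n \<beta> = e}" for \<beta>
        using that ext Suc.prems(4)[of \<beta>] by auto
    qed (use Suc.prems in auto)
    have "(\<Sum>\<beta>\<in>X. mass (\<psi> \<beta>)) = (\<Sum>e\<in>?N. \<Sum>\<beta>\<in>{\<beta>\<in>X. ?n \<beta> = e}. mass (\<psi> \<beta>))"
      using \<open>finite X\<close> by (rule sum.image_gen)
    also have "\<dots> \<le> (\<Sum>e\<in>?N. mass (\<psi> (\<gamma> @ [e])))"
      using step by (rule sum_mono)
    also have "\<dots> = (\<Sum>e\<in>?N. \<Sum>t\<in>UNIV. mass (K \<gamma> e t))"
      using N is_flowD(2)[OF \<psi> \<open>\<gamma> \<in> traces \<E>\<close>] by (intro sum.cong) (auto simp: mass_sum)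
    also have "\<dots> = (\<Sum>t\<in>UNIV. \<Sum>e\<in>?N. mass (K \<gamma> e t))"
      by (rule sum.swap)
    also have "\<dots> \<le> (\<Sum>t\<in>UNIV. \<psi> \<gamma> $ t)"
    proof (rule sum_mono)
      fix t
      show "(\<Sum>e\<in>?N. mass (K \<gamma> e t)) \<le> \<psi> \<gamma> $ t"
      proof (cases "X = {}")
        case True
        then show ?thesis
          using is_flowD(1)[OF \<psi> \<open>\<gamma> \<in> traces \<E>\<close>] by simp
      next
        case False
        then have "enabled \<E> \<gamma> \<noteq> {}"
          using N by auto
        moreover have "0 \<le> mass (K \<gamma> e t)" if "e \<in> enabled \<E> \<gamma>" for e
          using cone_over_nonneg[OF is_flowD(3)[OF \<psi> \<open>\<gamma> \<in> traces \<E>\<close> that] distribution_labelledD(1)[OF lab that]]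
          by (rule mass_nonneg)
        ultimately show ?thesis
          using N by (intro finite_sum_le_has_sum[OF is_flowD(4)[OF \<psi> \<open>\<gamma> \<in> traces \<E>\<close>]]) auto
      qed
    qed
    finally show ?thesis
      by (simp add: mass_def)
  qed
qed

section \<open>From flows back to schedulers\<close>

lemma is_schedulerI:
  assumes lab: "distribution_labelled \<E>"
    and dom: "\<And>\<alpha> e t. \<alpha> \<in> traces \<E> \<Longrightarrow> \<sigma> \<alpha> (e, t) = (if e \<in> enabled \<E> \<alpha> then Some (k \<alpha> e t) else None)"
    and cone: "\<And>\<alpha> e t. \<alpha> \<in> traces \<E> \<Longrightarrow> e \<in> enabled \<E> \<alpha> \<Longrightarrow> k \<alpha> e t \<in> cone_over (label \<E> e t)"
    and one: "\<And>\<alpha> t. \<alpha> \<in> traces \<E> \<Longrightarrow> enabled \<E> \<alpha> \<noteq> {} \<Longrightarrow>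
      ((\<lambda>e. mass (k \<alpha> e t)) has_sum 1) (enabled \<E> \<alpha>)"
  shows "is_scheduler \<E> \<sigma>"
  unfolding is_scheduler_def
proof (intro ballI conjI)
  fix \<alpha>
  assume \<alpha>: "\<alpha> \<in> traces \<E>"
  have nn: "0 \<le> k \<alpha> e t $ u" if "e \<in> enabled \<E> \<alpha>" for e t u
    using cone[OF \<alpha> that] distribution_labelledD(1)[OF lab that] by (rule cone_over_nonneg)
  have nn': "0 \<le> mass (k \<alpha> e t)" if "e \<in> enabled \<E> \<alpha>" for e t
    using nn[OF that] by (rule mass_nonneg)
  have le: "mass (k \<alpha> e t) \<le> 1" if e: "e \<in> enabled \<E> \<alpha>" for e t
  proof -
    have "enabled \<E> \<alpha> \<noteq> {}"
      using e by auto
    from finite_sum_le_has_sum[OF one[OF \<alpha> this], of "{e}"] e nn' show ?thesis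
      by auto
  qed
  show "dom (\<sigma> \<alpha>) = enabled \<E> \<alpha> \<times> UNIV"
    using dom[OF \<alpha>] by (auto simp: dom_def split: if_splits)
  show "ran (\<sigma> \<alpha>) \<subseteq> subdistributions"
  proof
    fix v
    assume "v \<in> ran (\<sigma> \<alpha>)"
    then obtain e t where "e \<in> enabled \<E> \<alpha>" "v = k \<alpha> e t"
      using dom[OF \<alpha>] by (auto simp: ran_def split: if_splits)
    then show "v \<in> subdistributions"
      using nn le[unfolded mass_def] by (auto simp: subdistributions_def)
  qed
  \<comment> \<open>The value 0 off the enabled events is a default: the weights must lie in the
    unit interval at all events.\<close>
  let ?w = "\<lambda>(e, t). if e \<in> enabled \<E> \<alpha> then mass (k \<alpha> e t) else 0"
  have "(\<exists>\<mu>\<in>label \<E> e t. k \<alpha> e t = mass (k \<alpha> e t) *\<^sub>R \<mu>)"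
    if "e \<in> enabled \<E> \<alpha>" "label \<E> e t \<noteq> {}" for e t
    using that cone_over_cases[OF cone[OF \<alpha> that(1)] distribution_labelledD(1)[OF lab that(1)]]
    by (metis all_not_in_conv scale_zero_left)
  moreover have "k \<alpha> e t = 0" if "e \<in> enabled \<E> \<alpha>" "label \<E> e t = {}" for e t
    using cone[OF \<alpha> that(1), of t] that(2) by (simp add: cone_over_def)
  moreover have "((\<lambda>e. ?w (e, t)) has_sum 1) (enabled \<E> \<alpha>)" if "enabled \<E> \<alpha> \<noteq> {}" for t
    using one[OF \<alpha> that, of t] by (subst has_sum_cong[where g = "\<lambda>e. mass (k \<alpha> e t)"]) auto
  ultimately show "\<exists>w :: 'a \<times> 'b \<Rightarrow> real.
        (\<forall>e\<in>events \<E>. \<forall>s. 0 \<le> w (e, s) \<and> w (e, s) \<le> 1) \<and>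
        (\<forall>e\<in>enabled \<E> \<alpha>. \<forall>s.
           (label \<E> e s \<noteq> {} \<longrightarrow> (\<exists>\<mu>\<in>label \<E> e s. \<sigma> \<alpha> (e, s) = Some (w (e, s) *\<^sub>R \<mu>))) \<and>
           (label \<E> e s = {} \<longrightarrow> w (e, s) = 0 \<and> \<sigma> \<alpha> (e, s) = Some 0)) \<and>
        (enabled \<E> \<alpha> \<noteq> {} \<longrightarrow> (\<forall>s. ((\<lambda>e. w (e, s)) has_sum 1) (enabled \<E> \<alpha>)))"
    using nn' le dom[OF \<alpha>] by (intro exI[of _ ?w]) simp
qed

text \<open>The outgoing flow is divided by the mass present in each state. At a state without mass
  any admissible choice will do, and feasibility supplies an enabled event with nonempty label,
  which receives the whole weight. The flow is recovered only for the mixture \<nu>, not for single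
  initial states.\<close>

lemma scheduler_of_flow:
  assumes \<psi>: "is_flow \<E> \<psi> K" and lab: "distribution_labelled \<E>" and feas: "feasible \<E>"
    and init: "\<psi> [] = (\<Sum>s\<in>UNIV. \<nu> s *\<^sub>R point s)"
  obtains \<tau> where "is_scheduler \<E> \<tau>" "\<And>\<alpha>. \<alpha> \<in> traces \<E> \<Longrightarrow> (\<Sum>s\<in>UNIV. \<nu> s *\<^sub>R phi \<tau> s \<alpha>) = \<psi> \<alpha>"
proof -
  define pick where "pick \<alpha> t = (SOME e. e \<in> enabled \<E> \<alpha> \<and> label \<E> e t \<noteq> {})" for \<alpha> t
  define k where "k \<alpha> e t = (if \<psi> \<alpha> $ t > 0 then (1 / \<psi> \<alpha> $ t) *\<^sub>R K \<alpha> e t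
      else if e = pick \<alpha> t then (SOME \<mu>. \<mu> \<in> label \<E> e t) else 0)" for \<alpha> e t
  define \<tau> where "\<tau> \<alpha> = (\<lambda>(e, t). if e \<in> enabled \<E> \<alpha> then Some (k \<alpha> e t) else None)" for \<alpha>
  have pick: "pick \<alpha> t \<in> enabled \<E> \<alpha>" "label \<E> (pick \<alpha> t) t \<noteq> {}"
    if "\<alpha> \<in> traces \<E>" "enabled \<E> \<alpha> \<noteq> {}" for \<alpha> t
  proof -
    have "\<alpha> \<in> traces \<E> - max_traces \<E>"
      using that enabled_max by blast
    then have "t \<in> (\<Union>e\<in>enabled \<E> \<alpha>. {s. label \<E> e s \<noteq> {}})"
      using feas unfolding feasible_def by blast
    then have "\<exists>e. e \<in> enabled \<E> \<alpha> \<and> label \<E> e t \<noteq> {}"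
      by blast
    from someI_ex[OF this] show "pick \<alpha> t \<in> enabled \<E> \<alpha>" "label \<E> (pick \<alpha> t) t \<noteq> {}"
      by (simp_all add: pick_def)
  qed
  have some: "(SOME \<mu>. \<mu> \<in> label \<E> (pick \<alpha> t) t) \<in> label \<E> (pick \<alpha> t) t"
    if "\<alpha> \<in> traces \<E>" "enabled \<E> \<alpha> \<noteq> {}" for \<alpha> t
    using pick(2)[OF that] by (simp add: some_in_eq)
  have cone: "k \<alpha> e t \<in> cone_over (label \<E> e t)" if "\<alpha> \<in> traces \<E>" "e \<in> enabled \<E> \<alpha>" for \<alpha> e t
  proof -
    have "(1 / \<psi> \<alpha> $ t) *\<^sub>R K \<alpha> e t \<in> cone_over (label \<E> e t)" if "\<psi> \<alpha> $ t > 0"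
      using is_flowD(3)[OF \<psi> \<open>\<alpha> \<in> traces \<E>\<close> \<open>e \<in> enabled \<E> \<alpha>\<close>] that by (intro cone_over_scaleR) auto
    moreover have "1 *\<^sub>R (SOME \<mu>. \<mu> \<in> label \<E> (pick \<alpha> t) t) \<in> cone_over (label \<E> (pick \<alpha> t) t)"
      using some that by (intro scaleR_in_cone_over) auto
    ultimately show ?thesis
      by (auto simp: k_def)
  qed
  have one: "((\<lambda>e. mass (k \<alpha> e t)) has_sum 1) (enabled \<E> \<alpha>)"
    if \<alpha>: "\<alpha> \<in> traces \<E>" and ne: "enabled \<E> \<alpha> \<noteq> {}" for \<alpha> t
  proof (cases "\<psi> \<alpha> $ t > 0")
    case True
    then show ?thesis
      using has_sum_cmult_right[OF is_flowD(4)[OF \<psi> \<alpha> ne, of t], of "1 / \<psi> \<alpha> $ t"]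
      by (simp add: k_def)
  next
    case False
    have "mass (SOME \<mu>. \<mu> \<in> label \<E> (pick \<alpha> t) t) = 1"
      using some[OF \<alpha> ne] distribution_labelledD(1)[OF lab pick(1)[OF \<alpha> ne]]
      by (intro mass_distribution) blast
    then show ?thesis
      using False pick(1)[OF \<alpha> ne]
      by (intro has_sum_finite_neutralI[of "{pick \<alpha> t}"]) (auto simp: k_def)
  qed
  have sched: "is_scheduler \<E> \<tau>"
    by (rule is_schedulerI[OF lab _ cone one]) (auto simp: \<tau>_def)
  have "(\<Sum>s\<in>UNIV. \<nu> s *\<^sub>R phi \<tau> s \<alpha>) = \<psi> \<alpha>" if "\<alpha> \<in> traces \<E>" for \<alpha>
    using that
  proof (induction \<alpha> rule: rev_induct)
    case Nil
    then show ?case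
      by (simp add: phi_Nil init)
  next
    case (snoc e \<alpha>)
    then have \<alpha>: "\<alpha> \<in> traces \<E>" and e: "e \<in> enabled \<E> \<alpha>"
      using traces_snocD(1) by (auto simp: enabled_traces)
    \<comment> \<open>Where no mass is present, the outgoing masses are nonnegative with sum 0, and
      a cone element of mass 0 vanishes. The arbitrary choice in \<open>k\<close> is therefore
      multiplied away.\<close>
    have K: "\<psi> \<alpha> $ t *\<^sub>R k \<alpha> e t = K \<alpha> e t" for t
    proof (cases "\<psi> \<alpha> $ t > 0")
      case False
      then have 0: "\<psi> \<alpha> $ t = 0"
        using is_flowD(1)[OF \<psi> \<alpha>, of t] by simp
      have nn: "0 \<le> mass (K \<alpha> e t)" if "e \<in> enabled \<E> \<alpha>" for e
        using cone_over_nonneg[OF is_flowD(3)[OF \<psi> \<alpha> that] distribution_labelledD(1)[OF lab that]]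
        by (rule mass_nonneg)
      have "enabled \<E> \<alpha> \<noteq> {}"
        using e by auto
      from finite_sum_le_has_sum[OF is_flowD(4)[OF \<psi> \<alpha> this], of "{e}" t] e nn 0
      have "mass (K \<alpha> e t) = 0"
        by (auto intro: antisym)
      then have "K \<alpha> e t = 0"
        using is_flowD(3)[OF \<psi> \<alpha> e] distribution_labelledD(1)[OF lab e] by (intro cone_over_mass_eq_0)
      then show ?thesis
        using 0 by simp
    qed (simp add: k_def)
    have "(\<Sum>s\<in>UNIV. \<nu> s *\<^sub>R phi \<tau> s (\<alpha> @ [e])) =
        (\<Sum>s\<in>UNIV. \<Sum>t\<in>UNIV. (\<nu> s *\<^sub>R phi \<tau> s \<alpha>) $ t *\<^sub>R k \<alpha> e t)"
      using e by (simp add: phi_append_singleton scaleR_sum_right \<tau>_def)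
    also have "\<dots> = (\<Sum>t\<in>UNIV. (\<Sum>s\<in>UNIV. \<nu> s *\<^sub>R phi \<tau> s \<alpha>) $ t *\<^sub>R k \<alpha> e t)"
      unfolding sum_component scaleR_sum_left by (rule sum.swap)
    also have "\<dots> = \<psi> (\<alpha> @ [e])"
      unfolding snoc.IH[OF \<alpha>] K using is_flowD(2)[OF \<psi> \<alpha> e] by simp
    finally show ?case .
  qed
  with sched show thesis
    by (rule that)
qed


section \<open>Transporting flows along simulations\<close>

lemma has_sum_sum:
  fixes f :: "'i \<Rightarrow> 'a \<Rightarrow> 'b::topological_comm_monoid_add"
  assumes "\<And>i. i \<in> I \<Longrightarrow> (f i has_sum s i) A"
  shows "((\<lambda>x. \<Sum>i\<in>I. f i x) has_sum (\<Sum>i\<in>I. s i)) A"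
  using assms by (induction I rule: infinite_finite_induct) (auto intro: has_sum_add)

lemma has_sum_diff_finite:
  fixes f :: "'a \<Rightarrow> 'b::topological_ab_group_add"
  assumes f: "(f has_sum S) A" and "finite B" "B \<subseteq> A"
  shows "(f has_sum (S - sum f B)) (A - B)"
proof -
  have "((\<lambda>x. f x + (if x \<in> B then - f x else 0)) has_sum (S + - sum f B)) A"
    using f by (rule has_sum_add)
      (rule has_sum_finite_neutralI[OF assms(2,3)], auto simp: sum_negf)
  moreover have "((\<lambda>x. f x + (if x \<in> B then - f x else 0)) has_sum c) A \<longleftrightarrow> (f has_sum c) (A - B)" for c
    by (rule has_sum_cong_neutral) (use \<open>B \<subseteq> A\<close> in auto)
  ultimately show ?thesis
    by simp
qed

locale flow_transport =
  fixes \<E> :: "('e, 's::finite) ipbes" and \<F> :: "('f, 's) ipbes"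
    and f :: "'e list \<Rightarrow> 'f list" and \<psi> :: "'e list \<Rightarrow> real^'s" and K :: "'e list \<Rightarrow> 'e \<Rightarrow> 's \<Rightarrow> real^'s"
  assumes f: "complete_t_simulation \<E> \<F> f"
    and labE: "distribution_labelled \<E>" and labF: "distribution_labelled \<F>"
    and \<psi>: "is_flow \<E> \<psi> K"
begin

lemmas fD = complete_t_simulationD[OF f]
lemmas \<psi>D = is_flowD[OF \<psi>]

section \<open>Fibres of the simulation\<close>

definition fibre :: "'f list \<Rightarrow> 'e list set" where
  "fibre \<beta> = {\<alpha> \<in> traces \<E>. f \<alpha> = \<beta>}"

definition silent :: "'e list \<Rightarrow> 'e set" where
  "silent \<alpha> = {e \<in> enabled \<E> \<alpha>. f (\<alpha> @ [e]) = f \<alpha>}"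

definition over :: "'e list \<Rightarrow> 'f \<Rightarrow> 'e set" where
  "over \<alpha> e' = {e \<in> enabled \<E> \<alpha>. f (\<alpha> @ [e]) = f \<alpha> @ [e']}"

lemma finite_fibre: "\<beta> \<in> traces \<F> \<Longrightarrow> finite (fibre \<beta>)"
  unfolding fibre_def by (rule fD(3))

lemma step_cases:
  assumes "e \<in> enabled \<E> \<alpha>"
  obtains "e \<in> silent \<alpha>" "label \<E> e \<sqsubseteq>\<^sub>H skip"
  | e' where "e \<in> over \<alpha> e'" "e' \<in> enabled \<F> (f \<alpha>)" "label \<E> e \<sqsubseteq>\<^sub>H label \<F> e'"
proof -
  have tr: "\<alpha> @ [e] \<in> traces \<E>"
    using assms by (simp add: enabled_traces)
  from fD(4)[OF tr] show thesis
  proof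
    assume "f (\<alpha> @ [e]) = f \<alpha> \<and> label \<E> e \<sqsubseteq>\<^sub>H skip"
    then show thesis
      using assms by (intro that(1)) (auto simp: silent_def)
  next
    assume "\<exists>e'\<in>events \<F>. label \<E> e \<sqsubseteq>\<^sub>H label \<F> e' \<and> f (\<alpha> @ [e]) = f \<alpha> @ [e']"
    then obtain e' where "label \<E> e \<sqsubseteq>\<^sub>H label \<F> e'" "f (\<alpha> @ [e]) = f \<alpha> @ [e']"
      by blast
    then show thesis
      using assms fD(1)[OF tr] by (intro that(2)[of e']) (auto simp: over_def enabled_traces)
  qed
qed

lemma over_label:
  assumes "e \<in> over \<alpha> e'"
  shows "label \<E> e \<sqsubseteq>\<^sub>H label \<F> e'"
proof -
  have "e \<in> enabled \<E> \<alpha>"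
    using assms by (simp add: over_def)
  then show ?thesis
    by (rule step_cases) (use assms in \<open>auto simp: over_def silent_def\<close>)
qed

lemma silent_label:
  assumes "e \<in> silent \<alpha>"
  shows "label \<E> e \<sqsubseteq>\<^sub>H skip"
proof -
  have "e \<in> enabled \<E> \<alpha>"
    using assms by (simp add: silent_def)
  then show ?thesis
    by (rule step_cases) (use assms in \<open>auto simp: over_def silent_def\<close>)
qed

text \<open>A silent extension of \<alpha> stays in the fibre of \<open>f \<alpha>\<close>, which is
  finite.\<close>

lemma finite_silent:
  assumes "\<alpha> \<in> traces \<E>"
  shows "finite (silent \<alpha>)"
proof (rule finite_imageD)
  show "finite ((\<lambda>e. \<alpha> @ [e]) ` silent \<alpha>)"
    by (rule finite_subset[OF _ finite_fibre[OF fD(1)[OF assms]]])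
      (auto simp: silent_def fibre_def enabled_traces)
qed (simp add: inj_on_def)

lemma finite_over:
  assumes "e' \<in> enabled \<F> (f \<alpha>)"
  shows "finite (over \<alpha> e')"
proof (rule finite_imageD)
  show "finite ((\<lambda>e. \<alpha> @ [e]) ` over \<alpha> e')"
    by (rule finite_subset[OF _ finite_fibre[of "f \<alpha> @ [e']"]])
      (use assms in \<open>auto simp: over_def fibre_def enabled_traces\<close>)
qed (simp add: inj_on_def)

text \<open>A label below \<open>skip\<close> contains at most the point distribution, so a silent
  event moves mass without changing its state.\<close>

lemma mass_silent:
  assumes \<alpha>: "\<alpha> \<in> traces \<E>" and e: "e \<in> silent \<alpha>"
  shows "mass (K \<alpha> e t) = \<psi> (\<alpha> @ [e]) $ t"
proof -
  have en: "e \<in> enabled \<E> \<alpha>"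
    using e by (simp add: silent_def)
  have "K \<alpha> e u = mass (K \<alpha> e u) *\<^sub>R point u" for u
  proof -
    have "label \<E> e u \<subseteq> {point u}"
      using silent_label[OF e] by (auto simp: hle_def skip_def)
    then show ?thesis
      using cone_over_cases[OF \<psi>D(3)[OF \<alpha> en] distribution_labelledD(1)[OF labE en]]
      by (metis scale_zero_left singletonD subsetD)
  qed
  then have "K \<alpha> e u $ t = (if u = t then mass (K \<alpha> e t) else 0)" for u
    by (metis mult.right_neutral mult_zero_right point_component real_scaleR_def vector_scaleR_component)
  then show ?thesis
    using \<psi>D(2)[OF \<alpha> en] by simp
qed

text \<open>The finitely many silent events are removed from the sum over enabled events and the
  rest is regrouped by image. At a maximal trace nothing leaves, hence the case distinction.\<close>

lemma has_sum_over:
  assumes \<alpha>: "\<alpha> \<in> traces \<E>"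
  shows "((\<lambda>e'. \<Sum>e\<in>over \<alpha> e'. mass (K \<alpha> e t)) has_sum
      ((if \<alpha> \<in> max_traces \<E> then 0 else \<psi> \<alpha> $ t) - (\<Sum>e\<in>silent \<alpha>. \<psi> (\<alpha> @ [e]) $ t))) (enabled \<F> (f \<alpha>))"
proof (cases "\<alpha> \<in> max_traces \<E>")
  case True
  then show ?thesis
    using enabled_max[OF True] by (simp add: over_def silent_def)
next
  case False
  then have "enabled \<E> \<alpha> \<noteq> {}"
    using \<alpha> by (auto simp: max_traces_iff enabled_def)
  from has_sum_diff_finite[OF \<psi>D(4)[OF \<alpha> this, of t] finite_silent[OF \<alpha>]]
  have "((\<lambda>e. mass (K \<alpha> e t)) has_sum (\<psi> \<alpha> $ t - (\<Sum>e\<in>silent \<alpha>. mass (K \<alpha> e t))))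
      (enabled \<E> \<alpha> - silent \<alpha>)"
    by (auto simp: silent_def)
  moreover have "bij_betw snd (Sigma (enabled \<F> (f \<alpha>)) (over \<alpha>)) (enabled \<E> \<alpha> - silent \<alpha>)"
    unfolding bij_betw_def
  proof
    show "inj_on snd (Sigma (enabled \<F> (f \<alpha>)) (over \<alpha>))"
      by (auto simp: inj_on_def over_def)
    have "e \<in> snd ` Sigma (enabled \<F> (f \<alpha>)) (over \<alpha>)" if "e \<in> enabled \<E> \<alpha> - silent \<alpha>" for e
      using that by (elim DiffE step_cases) force+
    then show "snd ` Sigma (enabled \<F> (f \<alpha>)) (over \<alpha>) = enabled \<E> \<alpha> - silent \<alpha>"
      by (auto simp: over_def silent_def)
  qed
  ultimately have "((\<lambda>p. mass (K \<alpha> (snd p) t)) has_sum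
      (\<psi> \<alpha> $ t - (\<Sum>e\<in>silent \<alpha>. mass (K \<alpha> e t)))) (Sigma (enabled \<F> (f \<alpha>)) (over \<alpha>))"
    using has_sum_reindex_bij_betw[of snd _ _ "\<lambda>e. mass (K \<alpha> e t)"] by blast
  then have "((\<lambda>e'. \<Sum>e\<in>over \<alpha> e'. mass (K \<alpha> e t)) has_sum
      (\<psi> \<alpha> $ t - (\<Sum>e\<in>silent \<alpha>. mass (K \<alpha> e t)))) (enabled \<F> (f \<alpha>))"
    by (rule has_sum_SigmaD) (simp add: finite_over has_sum_finite)
  then show ?thesis
    using False mass_silent[OF \<alpha>] by simp
qed

section \<open>Mass arriving along visible steps\<close>

definition live_step :: "'f list \<Rightarrow> 'f \<Rightarrow> 's \<Rightarrow> real^'s" where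
  "live_step \<beta> e' t = (\<Sum>\<alpha>\<in>fibre \<beta>. \<Sum>e\<in>over \<alpha> e'. K \<alpha> e t)"

text \<open>Mass is counted when it enters the fibre of \<beta>. Adding \<psi> over the whole fibre
  would count it anew after every silent step.\<close>

definition live :: "'f list \<Rightarrow> real^'s" where
  "live \<beta> = (if \<beta> = [] then \<psi> [] else \<Sum>t\<in>UNIV. live_step (butlast \<beta>) (last \<beta>) t)"

lemma live_snoc [simp]: "live (\<beta> @ [e']) = (\<Sum>t\<in>UNIV. live_step \<beta> e' t)"
  by (simp add: live_def)

lemma live_step_snoc:
  assumes "\<beta> \<in> traces \<F>"
  shows "(\<Sum>t\<in>UNIV. live_step \<beta> e' t) = (\<Sum>\<alpha>\<in>fibre \<beta>. \<Sum>e\<in>over \<alpha> e'. \<psi> (\<alpha> @ [e]))"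
proof -
  have "(\<Sum>t\<in>UNIV. live_step \<beta> e' t) = (\<Sum>\<alpha>\<in>fibre \<beta>. \<Sum>t\<in>UNIV. \<Sum>e\<in>over \<alpha> e'. K \<alpha> e t)"
    unfolding live_step_def by (rule sum.swap)
  also have "\<dots> = (\<Sum>\<alpha>\<in>fibre \<beta>. \<Sum>e\<in>over \<alpha> e'. \<Sum>t\<in>UNIV. K \<alpha> e t)"
    by (rule sum.cong[OF refl sum.swap])
  also have "\<dots> = (\<Sum>\<alpha>\<in>fibre \<beta>. \<Sum>e\<in>over \<alpha> e'. \<psi> (\<alpha> @ [e]))"
    by (intro sum.cong) (auto simp: fibre_def over_def \<psi>D(2))
  finally show ?thesis .
qed

text \<open>By clause (ii) the last event of a member either produced \<open>e'\<close>, which makes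
  the member a root of the fibre, or was silent.\<close>

lemma fibre_snoc:
  "fibre (\<beta> @ [e']) = (\<lambda>(\<alpha>, e). \<alpha> @ [e]) ` Sigma (fibre \<beta>) (\<lambda>\<alpha>. over \<alpha> e') \<union>
     (\<lambda>(\<alpha>, e). \<alpha> @ [e]) ` Sigma (fibre (\<beta> @ [e'])) silent"
proof (intro set_eqI iffI)
  fix \<gamma>
  assume \<gamma>: "\<gamma> \<in> fibre (\<beta> @ [e'])"
  show "\<gamma> \<in> (\<lambda>(\<alpha>, e). \<alpha> @ [e]) ` Sigma (fibre \<beta>) (\<lambda>\<alpha>. over \<alpha> e') \<union>
     (\<lambda>(\<alpha>, e). \<alpha> @ [e]) ` Sigma (fibre (\<beta> @ [e'])) silent"
  proof (cases \<gamma> rule: rev_cases)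
    case Nil
    then show ?thesis
      using \<gamma> fD(2) by (simp add: fibre_def)
  next
    case (snoc \<alpha> e)
    then have tr: "\<alpha> @ [e] \<in> traces \<E>" "f (\<alpha> @ [e]) = \<beta> @ [e']"
      using \<gamma> by (auto simp: fibre_def)
    then have "f \<alpha> = \<beta> @ [e'] \<and> e \<in> silent \<alpha> \<or> f \<alpha> = \<beta> \<and> e \<in> over \<alpha> e'"
      using fD(4)[OF tr(1)] by (auto simp: silent_def over_def enabled_traces)
    then show ?thesis
      using traces_snocD(1)[OF tr(1)] snoc by (force simp: fibre_def)
  qed
qed (auto simp: fibre_def over_def silent_def enabled_traces)

lemma fibre_Nil:
  "fibre [] = insert [] ((\<lambda>(\<alpha>, e). \<alpha> @ [e]) ` Sigma (fibre []) silent)"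
proof (intro set_eqI iffI)
  fix \<gamma>
  assume \<gamma>: "\<gamma> \<in> fibre []"
  show "\<gamma> \<in> insert [] ((\<lambda>(\<alpha>, e). \<alpha> @ [e]) ` Sigma (fibre []) silent)"
  proof (cases \<gamma> rule: rev_cases)
    case (snoc \<alpha> e)
    then have tr: "\<alpha> @ [e] \<in> traces \<E>" "f (\<alpha> @ [e]) = []"
      using \<gamma> by (auto simp: fibre_def)
    then have "f \<alpha> = [] \<and> e \<in> silent \<alpha>"
      using fD(4)[OF tr(1)] by (auto simp: silent_def over_def enabled_traces)
    then show ?thesis
      using traces_snocD(1)[OF tr(1)] snoc by (force simp: fibre_def)
  qed simp
qed (auto simp: fibre_def fD(2) silent_def enabled_traces)

lemma sum_snoc_image:
  assumes "finite A" "\<And>\<alpha>. \<alpha> \<in> A \<Longrightarrow> finite (B \<alpha>)"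
  shows "sum g ((\<lambda>(\<alpha>, e). \<alpha> @ [e]) ` Sigma A B) = (\<Sum>\<alpha>\<in>A. \<Sum>e\<in>B \<alpha>. g (\<alpha> @ [e]))"
proof -
  have "sum g ((\<lambda>(\<alpha>, e). \<alpha> @ [e]) ` Sigma A B) = (\<Sum>(\<alpha>, e)\<in>Sigma A B. g (\<alpha> @ [e]))"
    by (subst sum.reindex) (auto simp: inj_on_def split_beta)
  also have "\<dots> = (\<Sum>\<alpha>\<in>A. \<Sum>e\<in>B \<alpha>. g (\<alpha> @ [e]))"
    using assms by (subst sum.Sigma) auto
  finally show ?thesis .
qed

text \<open>The live mass at \<open>\<beta>\<close> enters the finite forest \<open>fibre \<beta>\<close> at its roots.\<close>

lemma sum_fibre:
  assumes \<beta>: "\<beta> \<in> traces \<F>"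
  shows "sum \<psi> (fibre \<beta>) = live \<beta> + (\<Sum>\<alpha>\<in>fibre \<beta>. \<Sum>e\<in>silent \<alpha>. \<psi> (\<alpha> @ [e]))"
proof -
  let ?S = "(\<lambda>(\<alpha>, e). \<alpha> @ [e]) ` Sigma (fibre \<beta>) silent"
  have fin: "finite (fibre \<beta>)" "\<And>\<alpha>. \<alpha> \<in> fibre \<beta> \<Longrightarrow> finite (silent \<alpha>)"
    using finite_fibre[OF \<beta>] finite_silent by (auto simp: fibre_def)
  have S: "sum \<psi> ?S = (\<Sum>\<alpha>\<in>fibre \<beta>. \<Sum>e\<in>silent \<alpha>. \<psi> (\<alpha> @ [e]))"
    using fin by (rule sum_snoc_image)
  have finS: "finite ?S"
    using fin by auto
  show ?thesis
  proof (cases \<beta> rule: rev_cases)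
    case Nil
    have "sum \<psi> (fibre []) = sum \<psi> (insert [] ?S)"
      using fibre_Nil Nil by simp
    also have "\<dots> = \<psi> [] + sum \<psi> ?S"
      using finS by (subst sum.insert) auto
    finally show ?thesis
      using S Nil by (simp add: live_def)
  next
    case (snoc \<beta>' e')
    let ?O = "(\<lambda>(\<alpha>, e). \<alpha> @ [e]) ` Sigma (fibre \<beta>') (\<lambda>\<alpha>. over \<alpha> e')"
    have \<beta>': "\<beta>' \<in> traces \<F>" and e': "e' \<in> enabled \<F> \<beta>'"
      using \<beta> snoc traces_snocD(1) by (auto simp: enabled_traces)
    have finO: "finite (fibre \<beta>')" "\<And>\<alpha>. \<alpha> \<in> fibre \<beta>' \<Longrightarrow> finite (over \<alpha> e')"
      using finite_fibre[OF \<beta>'] finite_over e' by (auto simp: fibre_def)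
    have "sum \<psi> (fibre \<beta>) = sum \<psi> (?O \<union> ?S)"
      using fibre_snoc[of \<beta>' e'] snoc by simp
    also have "\<dots> = sum \<psi> ?O + sum \<psi> ?S"
      using finO finS snoc by (intro sum.union_disjoint) (auto simp: fibre_def)
    also have "sum \<psi> ?O = live \<beta>"
      using sum_snoc_image[OF finO] live_step_snoc[OF \<beta>'] snoc by simp
    finally show ?thesis
      using S by simp
  qed
qed

definition stopped :: "'f list \<Rightarrow> 'e list set" where
  "stopped \<beta> = {\<alpha> \<in> max_traces \<E>. f \<alpha> = \<beta>}"

text \<open>Adding up the balances of all members of the fibre, the silent moves cancel by
  \<open>sum_fibre\<close>: what enters either leaves visibly or stops at a maximal trace.\<close>

lemma has_sum_live_step:
  assumes \<beta>: "\<beta> \<in> traces \<F>"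
  shows "((\<lambda>e'. mass (live_step \<beta> e' t)) has_sum (live \<beta> $ t - sum \<psi> (stopped \<beta>) $ t)) (enabled \<F> \<beta>)"
proof -
  have "((\<lambda>e'. \<Sum>e\<in>over \<alpha> e'. mass (K \<alpha> e t)) has_sum
      ((if \<alpha> \<in> max_traces \<E> then 0 else \<psi> \<alpha> $ t) - (\<Sum>e\<in>silent \<alpha>. \<psi> (\<alpha> @ [e]) $ t))) (enabled \<F> \<beta>)"
    if "\<alpha> \<in> fibre \<beta>" for \<alpha>
    using has_sum_over[of \<alpha> t] that by (simp add: fibre_def)
  then have "((\<lambda>e'. \<Sum>\<alpha>\<in>fibre \<beta>. \<Sum>e\<in>over \<alpha> e'. mass (K \<alpha> e t)) has_sum
      (\<Sum>\<alpha>\<in>fibre \<beta>. (if \<alpha> \<in> max_traces \<E> then 0 else \<psi> \<alpha> $ t) - (\<Sum>e\<in>silent \<alpha>. \<psi> (\<alpha> @ [e]) $ t)))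
      (enabled \<F> \<beta>)"
    by (rule has_sum_sum)
  moreover have "(\<Sum>\<alpha>\<in>fibre \<beta>. (if \<alpha> \<in> max_traces \<E> then 0 else \<psi> \<alpha> $ t) - (\<Sum>e\<in>silent \<alpha>. \<psi> (\<alpha> @ [e]) $ t)) =
      live \<beta> $ t - sum \<psi> (stopped \<beta>) $ t"
  proof -
    have fin: "finite (fibre \<beta>)"
      using \<beta> by (rule finite_fibre)
    have "(\<Sum>\<alpha>\<in>fibre \<beta>. if \<alpha> \<in> max_traces \<E> then 0 else \<psi> \<alpha> $ t) =
        (\<Sum>\<alpha>\<in>fibre \<beta>. \<psi> \<alpha> $ t) - (\<Sum>\<alpha>\<in>fibre \<beta>. if \<alpha> \<in> max_traces \<E> then \<psi> \<alpha> $ t else 0)"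
      by (subst sum_subtractf[symmetric], rule sum.cong) auto
    also have "(\<Sum>\<alpha>\<in>fibre \<beta>. if \<alpha> \<in> max_traces \<E> then \<psi> \<alpha> $ t else 0) =
        (\<Sum>\<alpha>\<in>stopped \<beta>. \<psi> \<alpha> $ t)"
    proof -
      have "fibre \<beta> \<inter> {\<alpha>. \<alpha> \<in> max_traces \<E>} = stopped \<beta>"
        by (auto simp: fibre_def stopped_def max_traces_subset)
      then show ?thesis
        using sum.inter_restrict[OF fin, of "\<lambda>\<alpha>. \<psi> \<alpha> $ t" "max_traces \<E>"] by simp
    qed
    finally show ?thesis
      using arg_cong[OF sum_fibre[OF \<beta>], of "\<lambda>v. v $ t"] by (simp add: sum_subtractf)
  qed
  ultimately show ?thesis
    by (simp add: live_step_def mass_sum)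
qed

text \<open>Mass that stops at a maximal \<open>\<alpha>\<close> travels from \<open>f \<alpha>\<close> to the maximal trace \<open>completion \<alpha>\<close>
  through events above \<open>skip\<close>, which can leave the state unchanged.\<close>

definition completion :: "'e list \<Rightarrow> 'f list" where
  "completion \<alpha> = (SOME \<beta>. \<beta> \<in> max_traces \<F> \<and> (\<exists>es. \<beta> = f \<alpha> @ es \<and> (\<forall>e\<in>set es. skip \<sqsubseteq>\<^sub>H label \<F> e)))"

lemma completion:
  assumes "\<alpha> \<in> max_traces \<E>"
  shows "completion \<alpha> \<in> max_traces \<F>"
    and "\<exists>es. completion \<alpha> = f \<alpha> @ es \<and> (\<forall>e\<in>set es. skip \<sqsubseteq>\<^sub>H label \<F> e)"
proof -
  have "\<exists>\<beta>. \<beta> \<in> max_traces \<F> \<and> (\<exists>es. \<beta> = f \<alpha> @ es \<and> (\<forall>e\<in>set es. skip \<sqsubseteq>\<^sub>H label \<F> e))"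
    using fD(6)[OF assms] unfolding weakly_maximal_def by blast
  from someI_ex[OF this] show "completion \<alpha> \<in> max_traces \<F>"
    "\<exists>es. completion \<alpha> = f \<alpha> @ es \<and> (\<forall>e\<in>set es. skip \<sqsubseteq>\<^sub>H label \<F> e)"
    by (simp_all add: completion_def)
qed

lemma prefix_completion: "\<alpha> \<in> max_traces \<E> \<Longrightarrow> prefix (f \<alpha>) (completion \<alpha>)"
  using completion(2) by (auto simp: prefix_def)

text \<open>Both ends of the route are included, so a trace that stops over \<beta> already counts
  as passing \<beta>.\<close>

definition passing :: "'f list \<Rightarrow> 'e list set" where
  "passing \<beta> = {\<alpha> \<in> max_traces \<E>. prefix (f \<alpha>) \<beta> \<and> prefix \<beta> (completion \<alpha>)}"

definition leaving :: "'f list \<Rightarrow> 'f \<Rightarrow> 'e list set" where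
  "leaving \<beta> e' = {\<alpha> \<in> passing \<beta>. prefix (\<beta> @ [e']) (completion \<alpha>)}"

text \<open>Every route through \<beta> starts at one of the finitely many prefixes of \<beta>, each
  of which has a finite fibre.\<close>

lemma finite_passing:
  assumes "\<beta> \<in> traces \<F>"
  shows "finite (passing \<beta>)"
proof (rule finite_subset)
  show "passing \<beta> \<subseteq> (\<Union>\<gamma>\<in>set (prefixes \<beta>). fibre \<gamma>)"
    by (auto simp: passing_def fibre_def max_traces_subset)
  show "finite \<dots>"
  proof (intro finite_UN_I finite_fibre)
    show "\<gamma> \<in> traces \<F>" if "\<gamma> \<in> set (prefixes \<beta>)" for \<gamma>
      using that assms by (auto simp: prefix_def dest: traces_appendD)
  qed simp
qed

text \<open>Traces whose route starts at \<beta> itself are left out, because their mass is already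
  part of \<open>live \<beta>\<close>.\<close>

definition out_mass :: "'f list \<Rightarrow> real^'s" where
  "out_mass \<beta> = live \<beta> + sum \<psi> {\<alpha> \<in> passing \<beta>. f \<alpha> \<noteq> \<beta>}"

definition out_step :: "'f list \<Rightarrow> 'f \<Rightarrow> 's \<Rightarrow> real^'s" where
  "out_step \<beta> e' t = live_step \<beta> e' t + (\<Sum>\<alpha>\<in>leaving \<beta> e'. \<psi> \<alpha> $ t) *\<^sub>R point t"

lemma passing_snoc: "{\<alpha> \<in> passing (\<beta> @ [e']). f \<alpha> \<noteq> \<beta> @ [e']} = leaving \<beta> e'"
  by (auto simp: passing_def leaving_def dest: append_prefixD)

lemma out_mass_snoc: "out_mass (\<beta> @ [e']) = (\<Sum>t\<in>UNIV. out_step \<beta> e' t)"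
proof -
  have "(\<Sum>t\<in>UNIV. (\<Sum>\<alpha>\<in>leaving \<beta> e'. \<psi> \<alpha> $ t) *\<^sub>R point t) = sum \<psi> (leaving \<beta> e')"
    using sum_point[of "sum \<psi> (leaving \<beta> e')"] by simp
  then show ?thesis
    unfolding out_mass_def passing_snoc out_step_def sum.distrib by simp
qed

lemma out_mass_stopped:
  assumes "\<beta> \<in> traces \<F>"
  shows "out_mass \<beta> = live \<beta> - sum \<psi> (stopped \<beta>) + sum \<psi> (passing \<beta>)"
proof -
  have "passing \<beta> = {\<alpha> \<in> passing \<beta>. f \<alpha> \<noteq> \<beta>} \<union> stopped \<beta>"
    by (auto simp: passing_def stopped_def prefix_completion)
  moreover have "sum \<psi> ({\<alpha> \<in> passing \<beta>. f \<alpha> \<noteq> \<beta>} \<union> stopped \<beta>) =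
      sum \<psi> {\<alpha> \<in> passing \<beta>. f \<alpha> \<noteq> \<beta>} + sum \<psi> (stopped \<beta>)"
  proof (rule sum.union_disjoint)
    show "finite (stopped \<beta>)"
      by (rule finite_subset[OF _ finite_fibre[OF assms]])
        (auto simp: stopped_def fibre_def max_traces_subset)
  qed (use finite_passing[OF assms] in \<open>auto simp: stopped_def\<close>)
  ultimately have "sum \<psi> (passing \<beta>) = sum \<psi> {\<alpha> \<in> passing \<beta>. f \<alpha> \<noteq> \<beta>} + sum \<psi> (stopped \<beta>)"
    by simp
  then show ?thesis
    by (simp add: out_mass_def)
qed

text \<open>A route ends at a maximal trace, which \<beta> is not, so each passing trace leaves
  through exactly one enabled event.\<close>

lemma has_sum_leaving:
  assumes \<beta>: "\<beta> \<in> traces \<F>" "enabled \<F> \<beta> \<noteq> {}"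
  shows "((\<lambda>e'. \<Sum>\<alpha>\<in>leaving \<beta> e'. \<psi> \<alpha> $ t) has_sum sum \<psi> (passing \<beta>) $ t) (enabled \<F> \<beta>)"
proof -
  have "((\<lambda>e'. if prefix (\<beta> @ [e']) (completion \<alpha>) then \<psi> \<alpha> $ t else 0) has_sum \<psi> \<alpha> $ t) (enabled \<F> \<beta>)"
    if \<alpha>: "\<alpha> \<in> passing \<beta>" for \<alpha>
  proof -
    have mx: "completion \<alpha> \<in> max_traces \<F>" "prefix \<beta> (completion \<alpha>)"
      using \<alpha> completion(1) by (auto simp: passing_def)
    moreover have "\<beta> \<notin> max_traces \<F>"
      using \<beta>(2) enabled_max by blast
    ultimately obtain e' \<delta> where e': "completion \<alpha> = \<beta> @ e' # \<delta>"
      by (metis append_Nil2 neq_Nil_conv prefix_def)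
    have "(\<beta> @ [e']) @ \<delta> \<in> traces \<F>"
      using max_traces_subset[OF mx(1)] e' by simp
    then have "e' \<in> enabled \<F> \<beta>"
      unfolding enabled_traces by (rule traces_appendD)
    then show ?thesis
      by (intro has_sum_finite_neutralI[of "{e'}"]) (auto simp: e')
  qed
  then have "((\<lambda>e'. \<Sum>\<alpha>\<in>passing \<beta>. if prefix (\<beta> @ [e']) (completion \<alpha>) then \<psi> \<alpha> $ t else 0) has_sum
      (\<Sum>\<alpha>\<in>passing \<beta>. \<psi> \<alpha> $ t)) (enabled \<F> \<beta>)"
    by (rule has_sum_sum)
  moreover have "(\<Sum>\<alpha>\<in>leaving \<beta> e'. \<psi> \<alpha> $ t) =
      (\<Sum>\<alpha>\<in>passing \<beta>. if prefix (\<beta> @ [e']) (completion \<alpha>) then \<psi> \<alpha> $ t else 0)" for e'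
    unfolding leaving_def using finite_passing[OF \<beta>(1)] by (rule sum.inter_filter)
  ultimately show ?thesis
    by simp
qed

lemma live_step_cone:
  assumes "\<beta> \<in> traces \<F>" "e' \<in> enabled \<F> \<beta>"
  shows "live_step \<beta> e' t \<in> cone_over (label \<F> e' t)"
proof -
  have cone: "K \<alpha> e t \<in> cone_over (label \<F> e' t)" if "\<alpha> \<in> fibre \<beta>" and e: "e \<in> over \<alpha> e'" for \<alpha> e
  proof -
    have "K \<alpha> e t \<in> cone_over (label \<E> e t)"
      using \<psi>D(3)[of \<alpha> e t] that by (simp add: fibre_def over_def)
    moreover have "label \<E> e t \<subseteq> label \<F> e' t"
      using over_label[OF e] by (simp add: hle_def)
    ultimately show ?thesis
      using cone_over_mono by blast
  qed
  have "convex (label \<F> e' t)"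
    using labF assms(2) by (rule distribution_labelledD)
  then show ?thesis
    unfolding live_step_def by (intro cone_over_sum cone)
qed

lemma max_nonneg: "\<alpha> \<in> max_traces \<E> \<Longrightarrow> 0 \<le> \<psi> \<alpha> $ t"
  using \<psi>D(1) max_traces_subset by blast

text \<open>If some route leaves through \<open>e'\<close>, then \<open>e'\<close> is one of its
  completing events and lies above \<open>skip\<close>; otherwise the vector is 0.\<close>

lemma leaving_cone:
  "(\<Sum>\<alpha>\<in>leaving \<beta> e'. \<psi> \<alpha> $ t) *\<^sub>R point t \<in> cone_over (label \<F> e' t)"
proof (cases "leaving \<beta> e' = {}")
  case False
  then obtain \<alpha> where \<alpha>: "\<alpha> \<in> leaving \<beta> e'"
    by blast
  then obtain es where es: "completion \<alpha> = f \<alpha> @ es" "\<forall>e\<in>set es. skip \<sqsubseteq>\<^sub>H label \<F> e"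
    using completion(2) by (auto simp: leaving_def passing_def)
  have "prefix (f \<alpha>) \<beta>" "prefix (\<beta> @ [e']) (f \<alpha> @ es)"
    using \<alpha> es by (auto simp: leaving_def passing_def)
  then have "e' \<in> set es"
    by (auto simp: prefix_def)
  then have "point t \<in> label \<F> e' t"
    using es(2) by (auto simp: hle_def skip_def)
  then show ?thesis
    by (rule scaleR_in_cone_over) (auto simp: leaving_def passing_def max_nonneg intro!: sum_nonneg)
qed simp

lemma live_nonneg:
  assumes "\<beta> \<in> traces \<F>"
  shows "0 \<le> live \<beta> $ t"
proof (cases \<beta> rule: rev_cases)
  case Nil
  then show ?thesis
    using \<psi>D(1)[of "[]"] by (simp add: live_def)
next
  case (snoc \<beta>' e')
  then have \<beta>': "\<beta>' \<in> traces \<F>" "e' \<in> enabled \<F> \<beta>'"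
    using assms traces_snocD(1) by (auto simp: enabled_traces)
  then show ?thesis
    using cone_over_nonneg[OF live_step_cone[OF \<beta>'] distribution_labelledD(1)[OF labF \<beta>'(2)]]
    by (auto simp: snoc intro!: sum_nonneg)
qed

lemma is_flow_out: "is_flow \<F> out_mass out_step"
  unfolding is_flow_def
proof (intro ballI conjI allI impI)
  fix \<beta> t
  assume \<beta>: "\<beta> \<in> traces \<F>"
  show "0 \<le> out_mass \<beta> $ t"
    using live_nonneg[OF \<beta>] by (auto simp: out_mass_def passing_def max_nonneg intro!: add_nonneg_nonneg sum_nonneg)
  show "out_mass (\<beta> @ [e']) = (\<Sum>t\<in>UNIV. out_step \<beta> e' t)" for e'
    by (rule out_mass_snoc)
  show "out_step \<beta> e' t \<in> cone_over (label \<F> e' t)" if "e' \<in> enabled \<F> \<beta>" for e' t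
    unfolding out_step_def
    using distribution_labelledD(2)[OF labF that] live_step_cone[OF \<beta> that] leaving_cone
    by (rule cone_over_add)
  show "((\<lambda>e'. mass (out_step \<beta> e' t)) has_sum out_mass \<beta> $ t) (enabled \<F> \<beta>)" if "enabled \<F> \<beta> \<noteq> {}"
    using has_sum_add[OF has_sum_live_step[OF \<beta>] has_sum_leaving[OF \<beta> that], of t t]
    by (simp add: out_step_def mass_add out_mass_stopped[OF \<beta>])
qed

text \<open>No event is enabled at \<beta>, so the balance of live mass is an empty sum and all live
  mass has stopped. What remains is the mass of the routes through \<beta>, and these end
  there.\<close>

lemma out_mass_max:
  assumes \<beta>: "\<beta> \<in> max_traces \<F>"
  shows "out_mass \<beta> = sum \<psi> {\<alpha> \<in> max_traces \<E>. completion \<alpha> = \<beta>}"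
proof -
  have tr: "\<beta> \<in> traces \<F>"
    using \<beta> by (rule max_traces_subset)
  have "live \<beta> $ t = sum \<psi> (stopped \<beta>) $ t" for t
    using has_sum_live_step[OF tr, of t] enabled_max[OF \<beta>] by (simp add: has_sum_finite_iff)
  then have "live \<beta> = sum \<psi> (stopped \<beta>)"
    by (simp add: vec_eq_iff)
  moreover have "completion \<alpha> = \<beta>" if "\<alpha> \<in> passing \<beta>" for \<alpha>
    using that completion(1) by (auto simp: passing_def intro!: max_traces_prefixD[OF \<beta>] max_traces_subset)
  then have "passing \<beta> = {\<alpha> \<in> max_traces \<E>. completion \<alpha> = \<beta>}"
    by (auto simp: passing_def prefix_completion)
  ultimately show ?thesis
    by (simp add: out_mass_stopped[OF tr])
qed

text \<open>The maximal traces of \<E> are regrouped by their completion, in finite groups.\<close>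

lemma has_sum_out_mass:
  assumes "(\<psi> has_sum M) (max_traces \<E>)"
  shows "(out_mass has_sum M) (max_traces \<F>)"
proof (rule has_sum_SigmaD)
  let ?B = "\<lambda>\<beta>. {\<alpha> \<in> max_traces \<E>. completion \<alpha> = \<beta>}"
  have "bij_betw snd (Sigma (max_traces \<F>) ?B) (max_traces \<E>)"
    unfolding bij_betw_def
  proof
    show "inj_on snd (Sigma (max_traces \<F>) ?B)"
      by (auto simp: inj_on_def)
    show "snd ` Sigma (max_traces \<F>) ?B = max_traces \<E>"
      using completion(1) by (force simp: image_iff)
  qed
  then show "((\<lambda>p. \<psi> (snd p)) has_sum M) (Sigma (max_traces \<F>) ?B)"
    using assms has_sum_reindex_bij_betw by blast
  show "((\<lambda>\<alpha>. \<psi> (snd (\<beta>, \<alpha>))) has_sum out_mass \<beta>) (?B \<beta>)" if \<beta>: "\<beta> \<in> max_traces \<F>" for \<beta>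
  proof -
    have "finite (?B \<beta>)"
      by (rule finite_subset[OF _ finite_passing[OF max_traces_subset[OF \<beta>]]])
        (auto simp: passing_def prefix_completion)
    then show ?thesis
      using out_mass_max[OF \<beta>] by (simp add: has_sum_finiteI)
  qed
qed

end


section \<open>Complete simulations are refinements\<close>

text \<open>The infinite sum defaults to 0 when it does not exist, and 0 is not a
  distribution.\<close>

lemma Sched1_has_sum_phi:
  assumes "\<sigma> \<in> Sched1 \<E>"
  shows "(phi \<sigma> s has_sum outcome \<E> \<sigma> s) (max_traces \<E>)"
proof -
  have "outcome \<E> \<sigma> s \<noteq> 0"
    using assms mass_distribution[of "outcome \<E> \<sigma> s"] by (auto simp: Sched1_def)
  then have "phi \<sigma> s summable_on max_traces \<E>"
    unfolding outcome_def using infsum_not_exists by blast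
  then show ?thesis
    unfolding outcome_def by (rule has_sum_infsum)
qed

lemma norm_distribution_le:
  assumes "\<mu> \<in> distributions"
  shows "norm \<mu> \<le> 1"
  using norm_le_l1_cart[of \<mu>] assms by (simp add: distributions_def)

lemma has_sum_mass: "(g has_sum v) A \<Longrightarrow> ((\<lambda>x. mass (g x)) has_sum mass v) A"
  unfolding mass_def by (rule has_sum_sum) (rule has_sum_bounded_linear[OF bounded_linear_vec_nth])

text \<open>The transported scheduler depends on the initial distribution.  Weighting every initial state
  positively forces it to terminate from all of them, and small weights for the states other than
  \<open>s\<^sub>0\<close> make the outcome from \<open>s\<^sub>0\<close> almost the required one.\<close>

lemma complete_sim_approx:
  fixes \<E> :: "('e, 's::finite) ipbes" and \<F> :: "('f, 's) ipbes" and \<epsilon> :: real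
  assumes sim: "\<E> \<sqsubseteq>\<^sub>c \<F>" and labE: "distribution_labelled \<E>" and labF: "distribution_labelled \<F>"
    and feas: "feasible \<F>" and \<sigma>: "\<sigma> \<in> Sched1 \<E>" and \<epsilon>: "\<epsilon> > 0"
  obtains \<tau> where "\<tau> \<in> Sched1 \<F>"
    "norm (outcome \<F> \<tau> s0 - outcome \<E> \<sigma> s0) \<le> \<epsilon> * (2 * CARD('s))"
proof -
  obtain f where f: "complete_t_simulation \<E> \<F> f"
    using sim by (auto simp: complete_sim_def)
  define \<nu> :: "'s \<Rightarrow> real" where "\<nu> s = (if s = s0 then 1 else \<epsilon>)" for s
  have \<nu>: "\<nu> s > 0" for s
    using \<epsilon> by (simp add: \<nu>_def)
  define \<psi> where "\<psi> = (\<lambda>\<alpha>. \<Sum>s\<in>UNIV. \<nu> s *\<^sub>R phi \<sigma> s \<alpha>)"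
  define M where "M = (\<Sum>s\<in>UNIV. \<nu> s *\<^sub>R outcome \<E> \<sigma> s)"
  have \<sigma>_sched: "is_scheduler \<E> \<sigma>" and out_\<sigma>: "outcome \<E> \<sigma> s \<in> distributions" for s
    using \<sigma> by (auto simp: Sched1_def)
  define K where "K \<alpha> e t = \<psi> \<alpha> $ t *\<^sub>R the (\<sigma> \<alpha> (e, t))" for \<alpha> e t
  have \<psi>_flow: "is_flow \<E> \<psi> K"
    unfolding \<psi>_def K_def using \<sigma>_sched labE less_imp_le[OF \<nu>] by (rule flow_of_scheduler)
  have \<psi>_sum: "(\<psi> has_sum M) (max_traces \<E>)"
    unfolding \<psi>_def M_def
  proof (rule has_sum_sum)
    show "((\<lambda>\<alpha>. \<nu> s *\<^sub>R phi \<sigma> s \<alpha>) has_sum \<nu> s *\<^sub>R outcome \<E> \<sigma> s) (max_traces \<E>)" for s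
      using Sched1_has_sum_phi[OF \<sigma>] by (rule has_sum_scaleR)
  qed
  interpret flow_transport \<E> \<F> f \<psi> K
    by unfold_locales (fact f labE labF \<psi>_flow)+
  have no_passing: "{\<alpha> \<in> passing []. f \<alpha> \<noteq> []} = {}"
    by (auto simp: passing_def)
  have "out_mass [] = \<psi> []"
    unfolding out_mass_def live_def no_passing by simp
  then have "out_mass [] = (\<Sum>s\<in>UNIV. \<nu> s *\<^sub>R point s)"
    by (simp only: \<psi>_def phi_Nil)
  then obtain \<tau> where \<tau>: "is_scheduler \<F> \<tau>"
    "\<And>\<beta>. \<beta> \<in> traces \<F> \<Longrightarrow> (\<Sum>s\<in>UNIV. \<nu> s *\<^sub>R phi \<tau> s \<beta>) = out_mass \<beta>"
    using scheduler_of_flow[OF is_flow_out labF feas] by blast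
  have out_sum: "(out_mass has_sum M) (max_traces \<F>)"
    using \<psi>_sum by (rule has_sum_out_mass)
  have nn: "0 \<le> phi \<tau> s \<beta> $ u" if "\<beta> \<in> max_traces \<F>" for s \<beta> u
    using phi_nonneg[OF \<tau>(1) labF max_traces_subset[OF that]] .
  \<comment> \<open>Since \<open>\<nu> s\<close> is positive, each component of
    \<open>phi \<tau> s\<close> is dominated by that of \<open>out_mass\<close> divided by
    \<open>\<nu> s\<close>. Summability is thus shown by components and reassembled with
    \<open>sum_point\<close>.\<close>
  have phi_sum: "(phi \<tau> s has_sum outcome \<F> \<tau> s) (max_traces \<F>)" for s
  proof -
    have "(\<lambda>\<beta>. phi \<tau> s \<beta> $ u) summable_on max_traces \<F>" for u
    proof (rule summable_on_comparison_test)
      show "(\<lambda>\<beta>. (1 / \<nu> s) * out_mass \<beta> $ u) summable_on max_traces \<F>"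
        by (rule summable_on_cmult_right, rule has_sum_imp_summable,
          rule has_sum_bounded_linear[OF bounded_linear_vec_nth out_sum])
      show "phi \<tau> s \<beta> $ u \<le> (1 / \<nu> s) * out_mass \<beta> $ u" if "\<beta> \<in> max_traces \<F>" for \<beta>
      proof -
        have "\<nu> s * phi \<tau> s \<beta> $ u \<le> (\<Sum>s\<in>UNIV. \<nu> s * phi \<tau> s \<beta> $ u)"
          using nn[OF that] less_imp_le[OF \<nu>] by (intro member_le_sum) auto
        also have "\<dots> = out_mass \<beta> $ u"
          by (simp add: \<tau>(2)[OF max_traces_subset[OF that], symmetric])
        finally show ?thesis
          using \<nu>[of s] by (simp add: field_simps)
      qed
    qed (use nn in simp)
    then have "((\<lambda>\<beta>. \<Sum>u\<in>UNIV. phi \<tau> s \<beta> $ u *\<^sub>R point u) has_sum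
        (\<Sum>u\<in>UNIV. infsum (\<lambda>\<beta>. phi \<tau> s \<beta> $ u) (max_traces \<F>) *\<^sub>R point u)) (max_traces \<F>)"
      by (intro has_sum_sum has_sum_bounded_linear[OF bounded_linear_scaleR_left], simp)
    then have "phi \<tau> s summable_on max_traces \<F>"
      unfolding sum_point by (rule has_sum_imp_summable)
    then show ?thesis
      unfolding outcome_def by (rule has_sum_infsum)
  qed
  have M: "(\<Sum>s\<in>UNIV. \<nu> s *\<^sub>R outcome \<F> \<tau> s) = M"
  proof (rule has_sum_unique)
    show "((\<lambda>\<beta>. \<Sum>s\<in>UNIV. \<nu> s *\<^sub>R phi \<tau> s \<beta>) has_sum (\<Sum>s\<in>UNIV. \<nu> s *\<^sub>R outcome \<F> \<tau> s)) (max_traces \<F>)"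
      by (rule has_sum_sum, rule has_sum_scaleR, rule phi_sum)
    show "((\<lambda>\<beta>. \<Sum>s\<in>UNIV. \<nu> s *\<^sub>R phi \<tau> s \<beta>) has_sum M) (max_traces \<F>)"
      using out_sum by (subst has_sum_cong[where g = out_mass]) (auto simp: \<tau>(2) max_traces_subset)
  qed
  have out_nn: "0 \<le> outcome \<F> \<tau> s $ u" for s u
    using has_sum_bounded_linear[OF bounded_linear_vec_nth phi_sum] nn by (rule has_sum_nonneg)
  \<comment> \<open>The weights \<open>?\<delta>\<close> single out one initial state, so
    \<open>phi \<tau> s\<close> is itself a flow, and it starts with mass 1 at the empty
    trace.\<close>
  have out_le: "mass (outcome \<F> \<tau> s) \<le> 1" for s
  proof (rule has_sum_le_finite_sums[OF has_sum_mass[OF phi_sum]])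
    fix X
    assume X: "finite X" "X \<subseteq> max_traces \<F>"
    let ?\<delta> = "\<lambda>s'. if s' = s then 1 else 0 :: real"
    have "(\<Sum>s'\<in>UNIV. ?\<delta> s' *\<^sub>R phi \<tau> s' \<alpha>) = phi \<tau> s \<alpha>" for \<alpha>
      by (subst sum.mono_neutral_cong_right[where S = "{s}"]) auto
    then have "is_flow \<F> (phi \<tau> s) (\<lambda>\<alpha> e t. phi \<tau> s \<alpha> $ t *\<^sub>R the (\<tau> \<alpha> (e, t)))"
      using flow_of_scheduler[OF \<tau>(1) labF, of ?\<delta>] by simp
    from flow_antichain_mass[OF this labF X, of "[]" "Max (length ` X)"] X(1)
    show "(\<Sum>\<beta>\<in>X. mass (phi \<tau> s \<beta>)) \<le> 1"
      by (simp add: phi_Nil)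
  qed
  \<comment> \<open>Termination from every state: the mixture loses no mass, no outcome exceeds mass
    1, and all weights are positive, so each outcome has mass exactly 1.\<close>
  have "mass M = sum \<nu> UNIV"
    by (simp add: M_def mass_sum mass_distribution[OF out_\<sigma>])
  then have "(\<Sum>s\<in>UNIV. \<nu> s * (1 - mass (outcome \<F> \<tau> s))) = 0"
    by (simp add: M[symmetric] mass_sum right_diff_distrib sum_subtractf)
  then have "\<forall>s\<in>UNIV. \<nu> s * (1 - mass (outcome \<F> \<tau> s)) = 0"
    using out_le less_imp_le[OF \<nu>] by (subst (asm) sum_nonneg_eq_0_iff) auto
  then have "mass (outcome \<F> \<tau> s) = 1" for s
    using less_imp_neq[OF \<nu>[of s]] by auto
  then have out_\<tau>: "outcome \<F> \<tau> s \<in> distributions" for s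
    using out_nn by (simp add: distributions_def mass_def)
  let ?d = "\<lambda>s. outcome \<F> \<tau> s - outcome \<E> \<sigma> s"
  \<comment> \<open>Both mixtures equal \<open>M\<close>, so the error at \<open>s0\<close> is
    balanced by the errors at the other states. These carry weight \<epsilon> and have norm at most
    2, being differences of distributions.\<close>
  have "(\<Sum>s\<in>UNIV. \<nu> s *\<^sub>R ?d s) = 0"
    using M by (simp add: M_def scaleR_diff_right sum_subtractf)
  moreover have "(\<Sum>s\<in>UNIV. \<nu> s *\<^sub>R ?d s) = ?d s0 + (\<Sum>s\<in>UNIV - {s0}. \<epsilon> *\<^sub>R ?d s)"
    by (subst sum.remove[of _ s0]) (auto simp: \<nu>_def)
  ultimately have "?d s0 = - (\<Sum>s\<in>UNIV - {s0}. \<epsilon> *\<^sub>R ?d s)"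
    by (simp add: eq_neg_iff_add_eq_0)
  then have "norm (?d s0) = norm (\<Sum>s\<in>UNIV - {s0}. \<epsilon> *\<^sub>R ?d s)"
    by (metis norm_minus_cancel)
  also have "\<dots> \<le> (\<Sum>s\<in>UNIV - {s0}. \<epsilon> * 2)"
  proof (rule sum_norm_le)
    fix s
    have "norm (?d s) \<le> norm (outcome \<F> \<tau> s) + norm (outcome \<E> \<sigma> s)"
      by (rule norm_triangle_ineq4)
    also have "\<dots> \<le> 2"
      using norm_distribution_le[OF out_\<tau>[of s]] norm_distribution_le[OF out_\<sigma>[of s]] by simp
    finally show "norm (\<epsilon> *\<^sub>R ?d s) \<le> \<epsilon> * 2"
      using \<epsilon> by simp
  qed
  also have "\<dots> \<le> (\<Sum>s\<in>(UNIV :: 's set). \<epsilon> * 2)"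
    using \<epsilon> by (intro sum_mono2) auto
  finally have "norm (?d s0) \<le> \<epsilon> * (2 * CARD('s))"
    by (simp add: mult_ac)
  moreover have "\<tau> \<in> Sched1 \<F>"
    using \<tau>(1) out_\<tau> by (simp add: Sched1_def)
  ultimately show thesis
    by (intro that)
qed

text \<open>Approximation of each outcome by outcomes of \<F> suffices, since
  \<open>sem \<F> s0\<close> is closed; its convexity then takes care of the hull on the side of
  \<E>.\<close>

theorem complete_sim_imp_refines:
  fixes \<E> :: "('e, 's::finite) ipbes" and \<F> :: "('f, 's) ipbes"
  assumes "\<E> \<sqsubseteq>\<^sub>c \<F>" "distribution_labelled \<E>" "distribution_labelled \<F>" "feasible \<F>"
  shows "\<E> \<sqsubseteq> \<F>"
  unfolding refines_def hle_def
proof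
  fix s0
  let ?O = "{outcome \<F> \<tau> s0 |\<tau>. \<tau> \<in> Sched1 \<F>}"
  have "outcome \<E> \<sigma> s0 \<in> closure ?O" if \<sigma>: "\<sigma> \<in> Sched1 \<E>" for \<sigma>
    unfolding closure_approachable
  proof (intro allI impI)
    fix r :: real
    assume "r > 0"
    \<comment> \<open>The further factor 2 turns the bound of \<open>complete_sim_approx\<close>
      into a strict one.\<close>
    define \<epsilon> where "\<epsilon> = r / (2 * (2 * CARD('s)))"
    have "\<epsilon> > 0" "\<epsilon> * (2 * CARD('s)) < r"
      using \<open>r > 0\<close> by (simp_all add: \<epsilon>_def)
    obtain \<tau> where \<tau>: "\<tau> \<in> Sched1 \<F>"
      "norm (outcome \<F> \<tau> s0 - outcome \<E> \<sigma> s0) \<le> \<epsilon> * (2 * CARD('s))"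
      using assms \<sigma> \<open>\<epsilon> > 0\<close> by (rule complete_sim_approx)
    have "dist (outcome \<F> \<tau> s0) (outcome \<E> \<sigma> s0) < r"
      using \<tau>(2) \<open>\<epsilon> * (2 * CARD('s)) < r\<close> unfolding dist_norm by (rule order.strict_trans1)
    then show "\<exists>y\<in>?O. dist y (outcome \<E> \<sigma> s0) < r"
      using \<tau>(1) by blast
  qed
  moreover have "closure ?O \<subseteq> sem \<F> s0"
    unfolding sem_def by (intro closure_mono hull_subset)
  ultimately have "{outcome \<E> \<sigma> s0 |\<sigma>. \<sigma> \<in> Sched1 \<E>} \<subseteq> sem \<F> s0"
    by auto
  moreover have "convex (sem \<F> s0)" "closed (sem \<F> s0)"
    unfolding sem_def by (simp_all add: convex_closure)
  ultimately show "sem \<E> s0 \<subseteq> sem \<F> s0"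
    unfolding sem_def[of \<E>] by (intro closure_minimal hull_minimal)
qed


section \<open>The concurrency rule\<close>

lemma distribution_labelled_guarded_product:
  assumes "guarded_product X \<A> \<B> \<C>" "distribution_labelled \<A>" "distribution_labelled \<B>"
  shows "distribution_labelled \<C>"
  using assms unfolding guarded_product_def distribution_labelled_def by (simp add: ball_Un)

lemmas distribution_labelled_par = distribution_labelled_guarded_product[OF guarded_product_par]
lemmas distribution_labelled_seq = distribution_labelled_guarded_product[OF guarded_product_seq]
lemmas feasible_par = feasible_guarded_product[OF guarded_product_par]
lemmas feasible_seq = feasible_guarded_product[OF guarded_product_seq]

text \<open>If \<F> had only the empty trace, all traces of \<E> would form one finite fibre. A
  longest trace of \<E> is then maximal and nonempty, and clause (iii) would append an event to its
  image. The lemma carries non-maximality of the empty trace along a simulation.\<close>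

lemma sim_Nil_nonmax:
  assumes "\<E> \<sqsubseteq>\<^sub>s\<^sub>i\<^sub>m \<F>" "[] \<notin> max_traces \<E>"
  shows "[] \<notin> max_traces \<F>"
proof
  assume "[] \<in> max_traces \<F>"
  then have F: "traces \<F> = {[]}"
    using max_traces_prefixD[of "[]" \<F>] by auto
  obtain f where f: "t_simulation \<E> \<F> f"
    using assms(1) by (auto simp: sim_def)
  have f_Nil: "f \<alpha> = []" if "\<alpha> \<in> traces \<E>" for \<alpha>
    using f F that by (auto simp: t_simulation_def Pi_iff)
  have "finite {\<alpha> \<in> traces \<E>. f \<alpha> = []}"
    using f F by (simp add: t_simulation_def)
  moreover have "{\<alpha> \<in> traces \<E>. f \<alpha> = []} = traces \<E>"
    using f_Nil by blast
  ultimately have "finite (traces \<E>)"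
    by simp
  then have fin: "finite (length ` traces \<E>)"
    by simp
  have "length ` traces \<E> \<noteq> {}"
    using Nil_in_traces[of \<E>] by blast
  from Max_in[OF fin this] obtain \<alpha> where \<alpha>: "\<alpha> \<in> traces \<E>" "Max (length ` traces \<E>) = length \<alpha>"
    by blast
  have "\<alpha> @ [e] \<notin> traces \<E>" for e
  proof
    assume "\<alpha> @ [e] \<in> traces \<E>"
    from Max_ge[OF fin imageI[OF this]] show False
      using \<alpha>(2) by simp
  qed
  then have mx: "\<alpha> \<in> max_traces \<E>"
    using \<alpha>(1) by (simp add: max_traces_iff)
  then obtain \<beta> e where "\<alpha> = \<beta> @ [e]"
    using assms(2) by (cases \<alpha> rule: rev_cases) auto
  then have "\<exists>e'. f \<alpha> = f \<beta> @ [e']"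
    using f mx unfolding t_simulation_def by blast
  then show False
    using f_Nil[OF \<alpha>(1)] by simp
qed

text \<open>The two conditions on the empty trace exclude inert \<E> and \<E>', for which clause
  (iii) of a simulation into \<open>G\<close> or \<open>G'\<close> is void. They make these
  simulations complete.\<close>

theorem mainTheorem9:
  fixes P :: "('p, 's::finite) ipbes"
    and \<E> :: "('e, 's) ipbes" and \<E>' :: "('e', 's) ipbes"
    and Q :: "('q, 's) ipbes" and Q' :: "('q', 's) ipbes"
    and R :: "('r, 's) ipbes" and R' :: "('r', 's) ipbes" and R'' :: "('r'', 's) ipbes"
    and G :: "('g, 's) ipbes" and G' :: "('g', 's) ipbes"
  assumes "prob_conc_program P" "prob_conc_program \<E>" "prob_conc_program \<E>'"
      "prob_conc_program Q" "prob_conc_program Q'"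
    and "rg_condition R" "rg_condition R'" "rg_condition G" "rg_condition G'" "rg_condition R''"
    and "R'' \<sqsubseteq>\<^sub>s\<^sub>i\<^sub>m R" "R'' \<sqsubseteq>\<^sub>s\<^sub>i\<^sub>m R'"
    and "[] \<notin> max_traces \<E>" "[] \<notin> max_traces \<E>'"
    and "quintuple P R \<E> G Q"
    and "quintuple P R' \<E>' G' Q'"
    and "G \<sqsubseteq>\<^sub>s\<^sub>i\<^sub>m R'" "G' \<sqsubseteq>\<^sub>s\<^sub>i\<^sub>m R"
  shows "quintuple P R'' (\<E> \<parallel>\<^sub>p \<E>') (G \<parallel>\<^sub>p G') Q"
proof -
  have sims: "\<E> \<sqsubseteq>\<^sub>s\<^sub>i\<^sub>m G" "\<E>' \<sqsubseteq>\<^sub>s\<^sub>i\<^sub>m G'" "R \<parallel>\<^sub>p R \<sqsubseteq>\<^sub>s\<^sub>i\<^sub>m R" and PQ: "P \<odot> (R \<parallel>\<^sub>p \<E>) \<sqsubseteq> Q"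
    using assms(6,15,16) by (simp_all add: quintuple_def rg_condition_def)
  have EG: "\<E> \<sqsubseteq>\<^sub>c G" and EG': "\<E>' \<sqsubseteq>\<^sub>c G'"
    using sim_imp_complete_sim[OF sims(1)] sim_imp_complete_sim[OF sims(2)] assms(13,14) by simp_all
  \<comment> \<open>The empty trace is not maximal in \<open>\<E>'\<close>, hence not in
    \<open>G'\<close> either, so no maximal empty trace has to be checked.\<close>
  have "G' \<sqsubseteq>\<^sub>c R"
    using sim_imp_complete_sim[OF assms(18)] sim_Nil_nonmax[OF sims(2) assms(14)] by simp
  with EG' have E'R: "\<E>' \<sqsubseteq>\<^sub>c R"
    by (rule complete_sim_trans)
  \<comment> \<open>If the empty trace is maximal in the product, it is maximal in \<open>R\<close>
    as well, which is the missing case of completeness.\<close>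
  have RR: "R \<parallel>\<^sub>p R \<sqsubseteq>\<^sub>c R"
    using sims(3) by (rule sim_imp_complete_sim) (rule max_weakly_maximal[OF Nil_max_par(1)])
  have ER: "\<E> \<parallel>\<^sub>p \<E>' \<sqsubseteq>\<^sub>c \<E> \<parallel>\<^sub>p R"
    using E'R by (rule par_mono_right)
  have "R'' \<parallel>\<^sub>p (\<E> \<parallel>\<^sub>p \<E>') \<sqsubseteq>\<^sub>c \<E> \<parallel>\<^sub>p R"
  proof (cases "[] \<in> max_traces R''")
    case True
    from complete_sim_trans[OF par_inert_left[OF this] ER] show ?thesis .
  next
    case False
    then have "R'' \<sqsubseteq>\<^sub>c R"
      using sim_imp_complete_sim[OF assms(11)] by simp
    then have "R'' \<parallel>\<^sub>p (\<E> \<parallel>\<^sub>p \<E>') \<sqsubseteq>\<^sub>c R \<parallel>\<^sub>p (\<E> \<parallel>\<^sub>p R)"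
      using ER by (rule par_mono)
    also have "\<dots> \<sqsubseteq>\<^sub>c (\<E> \<parallel>\<^sub>p R) \<parallel>\<^sub>p R"
      by (rule par_comm)
    also have "\<dots> \<sqsubseteq>\<^sub>c \<E> \<parallel>\<^sub>p (R \<parallel>\<^sub>p R)"
      by (rule par_assoc)
    also have "\<dots> \<sqsubseteq>\<^sub>c \<E> \<parallel>\<^sub>p R"
      using RR by (rule par_mono_right)
    finally show ?thesis .
  qed
  also have "\<E> \<parallel>\<^sub>p R \<sqsubseteq>\<^sub>c R \<parallel>\<^sub>p \<E>"
    by (rule par_comm)
  finally have "P \<odot> (R'' \<parallel>\<^sub>p (\<E> \<parallel>\<^sub>p \<E>')) \<sqsubseteq>\<^sub>c P \<odot> (R \<parallel>\<^sub>p \<E>)"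
    by (rule seq_mono_right)
  then have "P \<odot> (R'' \<parallel>\<^sub>p (\<E> \<parallel>\<^sub>p \<E>')) \<sqsubseteq> P \<odot> (R \<parallel>\<^sub>p \<E>)"
  proof (rule complete_sim_imp_refines)
    have "distribution_labelled P" "distribution_labelled R''" "distribution_labelled \<E>"
      "distribution_labelled \<E>'" "distribution_labelled R"
      using assms(1-3,6,10)
      by (simp_all add: rg_condition_def prob_conc_program_def is_ipbes_distribution_labelled)
    then show "distribution_labelled (P \<odot> (R'' \<parallel>\<^sub>p (\<E> \<parallel>\<^sub>p \<E>')))" "distribution_labelled (P \<odot> (R \<parallel>\<^sub>p \<E>))"
      by (simp_all add: distribution_labelled_par distribution_labelled_seq)
    have "feasible P" "feasible R" "feasible \<E>"
      using assms(1,2,6) by (simp_all add: rg_condition_def prob_conc_program_def)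
    then show "feasible (P \<odot> (R \<parallel>\<^sub>p \<E>))"
      by (simp add: feasible_par feasible_seq)
  qed
  then have "P \<odot> (R'' \<parallel>\<^sub>p (\<E> \<parallel>\<^sub>p \<E>')) \<sqsubseteq> Q"
    using PQ unfolding refines_def by (rule hle_trans)
  moreover have "\<E> \<parallel>\<^sub>p \<E>' \<sqsubseteq>\<^sub>s\<^sub>i\<^sub>m G \<parallel>\<^sub>p G'"
    using EG EG' by (intro complete_sim_imp_sim par_mono)
  ultimately show ?thesis
    by (simp add: quintuple_def)
qed

end
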